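(* Let $F\in C^1(\mathbb{R}^2,\mathbb{R}^2)$ with $D(x,y) = 1$ for all $(x,y)\in\mathbb{R}^2$. If there exists $z \in (-\infty,0) \cup S^1 \cup (0,+\infty)$ which is not an eigenvalue of $J_F(x,y)$ for any $(x,y) \in \mathbb{R}^2$, then $F$ is injective.
   Context: For $F=(P,Q)\in C^1(\mathbb{R}^2,\mathbb{R}^2)$, $J_F(x,y)=\begin{pmatrix}P_x & P_y\\ Q_x & Q_y\end{pmatrix}(x,y)$ is the Jacobian matrix and $D(x,y)=\det J_F(x,y)$. Eigenvalues are complex eigenvalues, $S^1$ is the unit circle in $\mathbb{C}$, and $(-\infty,0)$, $(0,+\infty)$ are the open real half-axes in $\mathbb{C}$. *)

theory Defs
  imports "HOL-Analysis.Analysis"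
begin

definition C1_map :: "(real ^ 'n \<Rightarrow> real ^ 'm) \<Rightarrow> bool" where
  "C1_map F \<longleftrightarrow>
     (\<forall>p. F differentiable (at p)) \<and> continuous_on UNIV (\<lambda>p. jacobian F (at p))"

text \<open>The entries of \<^const>\<open>jacobian\<close> are the partial derivatives: rows are indexed by the
  components of the map, columns by the variables.\<close>

lemma jacobian_entry_partial_derivative:
  fixes F :: "real ^ 'n \<Rightarrow> real ^ 'm"
  assumes "F differentiable (at p)"
  shows "((\<lambda>t. F (p + t *\<^sub>R axis j 1) $ i) has_real_derivative jacobian F (at p) $ i $ j) (at 0)"
proof -
  let ?g = "\<lambda>t::real. p + t *\<^sub>R axis j 1"
  have F: "(F has_derivative (\<lambda>h. jacobian F (at p) *v h)) (at (?g 0))"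
    using assms by (simp add: jacobian_works)
  have g: "(?g has_derivative (\<lambda>t. t *\<^sub>R axis j 1)) (at 0)"
    by (auto intro!: derivative_eq_intros)
  have "((\<lambda>t. F (?g t)) has_derivative (\<lambda>t. jacobian F (at p) *v (t *\<^sub>R axis j 1))) (at 0)"
    using diff_chain_at[OF g F] by (simp add: o_def)
  then have "((\<lambda>t. F (?g t) $ i) has_derivative
      (\<lambda>t. (jacobian F (at p) *v (t *\<^sub>R axis j 1)) $ i)) (at 0)"
    by (rule bounded_linear.has_derivative[OF bounded_linear_vec_nth])
  moreover have "(\<lambda>t. (jacobian F (at p) *v (t *\<^sub>R axis j 1)) $ i)
      = (*) (jacobian F (at p) $ i $ j)"
    by (auto simp: fun_eq_iff matrix_vector_mult_def axis_def if_distrib cong: if_cong)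
  ultimately show ?thesis
    by (simp add: has_field_derivative_def)
qed

definition complex_eigenvalue :: "real ^ 'n ^ 'n \<Rightarrow> complex \<Rightarrow> bool" where
  "complex_eigenvalue A z \<longleftrightarrow>
     (\<exists>v :: complex ^ 'n. v \<noteq> 0 \<and> map_matrix complex_of_real A *v v = z *s v)"

end

theory Submission
  imports Defs
begin

text \<open>Let \<open>t\<close> be the trace of the Jacobian matrix of \<open>F\<close>. Since the determinant is \<open>1\<close>, the
  eigenvalues are the roots of \<open>X\<^sup>2 - t X + 1\<close>; for \<open>z\<close> real and nonzero, or of modulus \<open>1\<close>, the
  number \<open>c = z + 1/z\<close> is real, and \<open>z\<close> is an eigenvalue exactly where \<open>t = c\<close>. So the continuous
  function \<open>t\<close> omits the value \<open>c\<close>, and replacing \<open>F\<close> by \<open>-F\<close> if necessary, \<open>t < c\<close> everywhere.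
  A positive eigenvalue \<open>\<lambda>\<close> satisfies \<open>\<lambda> + 1/\<lambda> < c\<close>, so it cannot be small, while negative
  eigenvalues may accumulate at \<open>0\<close>. The map \<open>F - s id\<close> with a small \<open>s > 0\<close> repairs this: its
  Jacobian determinant is positive and its real eigenvalues stay away from \<open>0\<close> on \<^emph>\<open>both\<close> sides.
  By Brouwer's fixed point theorem a coincidence \<open>F a = F b\<close> survives in \<open>F - s id\<close> for small \<open>s\<close>
  (\<open>coincidence_persists\<close>). It remains to prove \<open>inj_G\<close>: a \<open>C\<^sup>1\<close> map \<open>G\<close> of the plane whose Jacobian
  determinant is positive and whose real eigenvalues have modulus at least \<open>\<delta> > 0\<close> is injective.

  If \<open>G\<close> is not injective, then a local inverse of \<open>G\<close> along two sides of some triangle does not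
  extend to the triangle (\<open>unfillable_triangle\<close>). Put the two sides on the coordinate axes and push a
  line \<open>q + b p = l\<close> away from the origin, extending the local inverse \<open>H\<close> below it. For every \<open>b\<close>
  slightly above \<open>1\<close> the line is stopped at some \<open>l\<close>, and \<open>H\<close> is unbounded below that line. Where \<open>y + b x\<close>,
  evaluated on the image of \<open>H\<close>, is extremal along a moving line, its speed is a real eigenvalue of the
  derivative of \<open>H\<close>, hence at most \<open>1/\<delta>\<close>. So \<open>H\<close> maps the swept region into a strip
  \<open>\<bar>y + b x\<bar> \<le> C\<close> (\<open>image_in_strip\<close>) and runs to infinity inside it, towards one of its two ends.
  Infinitely many slopes leave only two choices of an end, so three slopes use the same end.

  Segments of three stopped lines with these slopes form a convex polygonal path on which \<open>H\<close> goes
  far out in the first strip, then in the second, then in the third. At the point of extreme abscissa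
  in the second strip the image curve moves vertically, and the sign of the determinant decides to
  which side: towards the first strip, although the curve came from there.
  A curve that does this crosses itself (\<open>no_backward_contact\<close>, from the Fashoda theorem), which is
  absurd because \<open>G \<circ> H\<close> is the identity.\<close>

section \<open>Local inverses of locally injective maps\<close>

definition section_on :: "('a::metric_space \<Rightarrow> 'a) \<Rightarrow> 'a set \<Rightarrow> ('a \<Rightarrow> 'a) \<Rightarrow> bool" where
  "section_on G S H \<longleftrightarrow> continuous_on S H \<and> (\<forall>w\<in>S. G (H w) = w)"

lemma section_on_subset: "section_on G S H \<Longrightarrow> T \<subseteq> S \<Longrightarrow> section_on G T H"
  unfolding section_on_def using continuous_on_subset by blast

lemma section_on_cong: "(\<And>w. w \<in> S \<Longrightarrow> H w = K w) \<Longrightarrow> section_on G S H \<longleftrightarrow> section_on G S K"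
  unfolding section_on_def by (metis continuous_on_cong)

definition locally_injective :: "('a::metric_space \<Rightarrow> 'a) \<Rightarrow> bool" where
  "locally_injective G \<longleftrightarrow> (\<forall>x. \<exists>r>0. inj_on G (ball x r))"

text \<open>Local injectivity makes the set of agreement open, and its complement is open because the two
  sections are continuous.\<close>

lemma section_unique:
  assumes G: "locally_injective G"
    and S: "connected S"
    and H: "section_on G S H" and K: "section_on G S K"
    and z: "z \<in> S" "H z = K z" and w: "w \<in> S"
  shows "H w = K w"
proof (rule connected_induction [OF S, of "\<lambda>_. True" "\<lambda>w. H w = K w" z w])
  fix a assume a: "a \<in> S"
  have "openin (top_of_set S) (S \<inter> H -` U)" "openin (top_of_set S) (S \<inter> K -` U)" if "open U" for U
    using H K that unfolding section_on_def by (blast intro: continuous_openin_preimage_gen)+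
  note op = this
  show "\<exists>T. openin (top_of_set S) T \<and> a \<in> T \<and>
            (\<forall>x\<in>T. \<forall>y\<in>T. True \<and> True \<and> H x = K x \<longrightarrow> H y = K y)"
  proof (cases "H a = K a")
    case True
    obtain r where r: "r > 0" "inj_on G (ball (H a) r)"
      using G unfolding locally_injective_def by blast
    let ?T = "(S \<inter> H -` ball (H a) r) \<inter> (S \<inter> K -` ball (H a) r)"
    have "openin (top_of_set S) ?T"
      by (intro openin_Int op open_ball)
    moreover have "a \<in> ?T" using a r True by simp
    moreover have "H y = K y" if "y \<in> ?T" for y
    proof (rule inj_onD [OF r(2)])
      show "G (H y) = G (K y)" using that H K unfolding section_on_def by auto
    qed (use that in auto)
    ultimately show ?thesis by blast
  next
    case False
    obtain U V where UV: "open U" "open V" "H a \<in> U" "K a \<in> V" "U \<inter> V = {}"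
      using hausdorff [OF False] by blast
    let ?T = "(S \<inter> H -` U) \<inter> (S \<inter> K -` V)"
    have "openin (top_of_set S) ?T"
      by (intro openin_Int op UV)
    moreover have "a \<in> ?T" using a UV by simp
    moreover have "H y \<noteq> K y" if "y \<in> ?T" for y using that UV by auto
    ultimately show ?thesis by blast
  qed
qed (use z w in auto)

lemma tendsto_close:
  fixes c x :: "nat \<Rightarrow> 'a::metric_space"
  assumes c: "c \<longlonglongrightarrow> p" and d: "(\<lambda>n. dist (c n) (x n)) \<longlonglongrightarrow> 0"
  shows "x \<longlonglongrightarrow> p"
proof -
  have "(\<lambda>n. dist (c n) (x n) + dist (c n) p) \<longlonglongrightarrow> 0 + 0"
    using d c[THEN tendsto_dist_iff[THEN iffD1]] by (rule tendsto_add)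
  then have lim: "(\<lambda>n. dist (c n) (x n) + dist (c n) p) \<longlonglongrightarrow> 0" by simp
  have "(\<lambda>n. dist (x n) p) \<longlonglongrightarrow> 0"
  proof (rule tendsto_sandwich [OF _ _ tendsto_const lim])
    show "\<forall>\<^sub>F n in sequentially. 0 \<le> dist (x n) p" by simp
    show "\<forall>\<^sub>F n in sequentially. dist (x n) p \<le> dist (c n) (x n) + dist (c n) p"
      by (rule always_eventually) (metis dist_commute dist_triangle)
  qed
  then show ?thesis by (rule tendsto_dist_iff[THEN iffD2])
qed

text \<open>Otherwise coincidences \<open>G x = G y\<close> with \<open>x \<noteq> y\<close> occur arbitrarily close to the compact set. Their limit
  points lie in the set and have equal values, so they are one point, at which \<open>G\<close> is not locally
  injective.\<close>

lemma inj_on_open_superset_of_compact: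
  fixes G :: "'a::metric_space \<Rightarrow> 'a"
  assumes G: "locally_injective G" and cont: "continuous_on UNIV G"
    and C: "compact C" and inj: "inj_on G C"
  obtains U where "open U" "C \<subseteq> U" "inj_on G U"
proof (cases "C = {}")
  case True
  then show ?thesis using that[of "{}"] by auto
next
  case False
  have isCont: "isCont G x" for x
    using cont by (simp add: continuous_on_eq_continuous_at)
  have "\<exists>n. inj_on G (\<Union>c\<in>C. ball c (inverse (real (Suc n))))"
  proof (rule ccontr)
    assume neg: "\<not> ?thesis"
    have "\<exists>z. fst (fst z) \<noteq> snd (fst z) \<and> G (fst (fst z)) = G (snd (fst z)) \<and>
        fst (snd z) \<in> C \<and> snd (snd z) \<in> C \<and>
        dist (fst (snd z)) (fst (fst z)) < inverse (real (Suc n)) \<and>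
        dist (snd (snd z)) (snd (fst z)) < inverse (real (Suc n))" for n
    proof -
      have "\<not> inj_on G (\<Union>c\<in>C. ball c (inverse (real (Suc n))))" using neg by blast
      then obtain x y where xy: "x \<in> (\<Union>c\<in>C. ball c (inverse (real (Suc n))))"
        "y \<in> (\<Union>c\<in>C. ball c (inverse (real (Suc n))))" "G x = G y" "x \<noteq> y"
        unfolding inj_on_def by blast
      obtain c d where "c \<in> C" "d \<in> C" "dist c x < inverse (real (Suc n))"
        "dist d y < inverse (real (Suc n))"
        using xy(1,2) unfolding UN_iff mem_ball by blast
      then show ?thesis using xy by (intro exI[of _ "((x, y), (c, d))"]) simp
    qed
    then obtain z where z: "\<And>n. fst (fst (z n)) \<noteq> snd (fst (z n)) \<and> G (fst (fst (z n))) = G (snd (fst (z n))) \<and>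
        fst (snd (z n)) \<in> C \<and> snd (snd (z n)) \<in> C \<and>
        dist (fst (snd (z n))) (fst (fst (z n))) < inverse (real (Suc n)) \<and>
        dist (snd (snd (z n))) (snd (fst (z n))) < inverse (real (Suc n))"
      using choice[of "\<lambda>n z. fst (fst z) \<noteq> snd (fst z) \<and> G (fst (fst z)) = G (snd (fst z)) \<and>
        fst (snd z) \<in> C \<and> snd (snd z) \<in> C \<and>
        dist (fst (snd z)) (fst (fst z)) < inverse (real (Suc n)) \<and>
        dist (snd (snd z)) (snd (fst z)) < inverse (real (Suc n))"] by blast
    define x y c d where "x = (\<lambda>n. fst (fst (z n)))" and "y = (\<lambda>n. snd (fst (z n)))"
      and "c = (\<lambda>n. fst (snd (z n)))" and "d = (\<lambda>n. snd (snd (z n)))"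
    have *: "x n \<noteq> y n" "G (x n) = G (y n)" "c n \<in> C" "d n \<in> C"
      "dist (c n) (x n) < inverse (real (Suc n))" "dist (d n) (y n) < inverse (real (Suc n))" for n
      using z[of n] unfolding x_def y_def c_def d_def by blast+
    have "\<forall>n. (c n, d n) \<in> C \<times> C" using *(3,4) by blast
    moreover have "compact (C \<times> C)" using C by (simp add: compact_Times)
    ultimately obtain l r where l: "l \<in> C \<times> C" and r: "strict_mono (r :: nat \<Rightarrow> nat)"
      and lim: "((\<lambda>n. (c n, d n)) \<circ> r) \<longlonglongrightarrow> l"
      unfolding compact_def by (elim allE[of _ "\<lambda>n. (c n, d n)"]) blast
    obtain p q where pq: "l = (p, q)" by (cases l)
    have c: "(\<lambda>n. c (r n)) \<longlonglongrightarrow> p" and d: "(\<lambda>n. d (r n)) \<longlonglongrightarrow> q"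
      using tendsto_fst [OF lim] tendsto_snd [OF lim] unfolding pq o_def by simp_all
    have inv0: "(\<lambda>n. inverse (real (Suc (r n)))) \<longlonglongrightarrow> 0"
      using LIMSEQ_subseq_LIMSEQ [OF LIMSEQ_inverse_real_of_nat r] by (simp add: o_def)
    have "(\<lambda>n. dist (c (r n)) (x (r n))) \<longlonglongrightarrow> 0"
      by (rule tendsto_sandwich [OF _ _ tendsto_const inv0])
         (use less_imp_le[OF *(5)] less_imp_le[OF *(6)] in \<open>simp_all del: of_nat_Suc\<close>)
    then have x: "(\<lambda>n. x (r n)) \<longlonglongrightarrow> p"
      by (rule tendsto_close [OF c])
    have "(\<lambda>n. dist (d (r n)) (y (r n))) \<longlonglongrightarrow> 0"
      by (rule tendsto_sandwich [OF _ _ tendsto_const inv0])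
         (use less_imp_le[OF *(5)] less_imp_le[OF *(6)] in \<open>simp_all del: of_nat_Suc\<close>)
    then have y: "(\<lambda>n. y (r n)) \<longlonglongrightarrow> q"
      by (rule tendsto_close [OF d])
    have "(\<lambda>n. G (x (r n))) \<longlonglongrightarrow> G p" "(\<lambda>n. G (y (r n))) \<longlonglongrightarrow> G q"
      by (rule isCont_tendsto_compose [OF isCont x], rule isCont_tendsto_compose [OF isCont y])
    then have "G p = G q" unfolding *(2) by (rule LIMSEQ_unique)
    then have "p = q" using inj l pq by (auto simp: inj_on_def)
    obtain \<rho> where \<rho>: "\<rho> > 0" "inj_on G (ball p \<rho>)"
      using G unfolding locally_injective_def by blast
    have "\<forall>\<^sub>F n in sequentially. x (r n) \<in> ball p \<rho> \<and> y (r n) \<in> ball p \<rho>"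
      using topological_tendstoD[OF x open_ball, of p \<rho>] topological_tendstoD[OF y open_ball, of p \<rho>]
        \<rho> \<open>p = q\<close> by (auto intro: eventually_conj)
    then obtain n where "x (r n) \<in> ball p \<rho>" "y (r n) \<in> ball p \<rho>"
      using eventually_happens' [OF sequentially_bot] by blast
    then show False using inj_onD[OF \<rho>(2) *(2)] *(1) by blast
  qed
  then obtain n where n: "inj_on G (\<Union>c\<in>C. ball c (inverse (real (Suc n))))" ..
  show ?thesis
  proof (rule that[OF _ _ n])
    show "C \<subseteq> (\<Union>c\<in>C. ball c (inverse (real (Suc n))))" by (auto simp del: of_nat_Suc intro!: bexI)
  qed auto
qed

text \<open>The image of a section over a compact set is a compact set on which \<open>G\<close> is injective, so \<open>G\<close> is
  injective near it, and invariance of domain makes the inverse there continuous on an open set.\<close>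

lemma section_extends_to_open:
  fixes G :: "'a::euclidean_space \<Rightarrow> 'a"
  assumes G: "locally_injective G" and cont: "continuous_on UNIV G"
    and K: "compact K" and H: "section_on G K H"
  obtains U H' where "open U" "K \<subseteq> U" "section_on G U H'" "\<And>w. w \<in> K \<Longrightarrow> H' w = H w"
proof -
  have C: "compact (H ` K)" and inj: "inj_on G (H ` K)"
    using H K unfolding section_on_def by (auto intro: compact_continuous_image simp: inj_on_def)
  obtain V where V: "open V" "H ` K \<subseteq> V" "inj_on G V"
    using inj_on_open_superset_of_compact [OF G cont C inj] .
  have cV: "continuous_on V G" using cont continuous_on_subset by blast
  show thesis
  proof
    show "open (G ` V)" by (rule invariance_of_domain [OF cV V(1,3)])
    show "K \<subseteq> G ` V"
      using H V(2) unfolding section_on_def by (metis image_eqI image_subset_iff subsetI)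
    show "section_on G (G ` V) (inv_into V G)"
      unfolding section_on_def
      using continuous_on_inverse_open [OF V(1) cV] V by (auto simp: f_inv_into_f)
    show "inv_into V G w = H w" if "w \<in> K" for w
      using that H V unfolding section_on_def
      by (metis image_subset_iff inv_into_f_f)
  qed
qed

lemma section_glue:
  fixes G :: "'a::metric_space \<Rightarrow> 'a"
  assumes G: "locally_injective G"
    and S: "closed S" "section_on G S H" and T: "closed T" "section_on G T K"
    and conn: "connected (S \<inter> T)" and z: "z \<in> S \<inter> T" "H z = K z"
  obtains L where "section_on G (S \<union> T) L"
    "\<And>w. w \<in> S \<Longrightarrow> L w = H w" "\<And>w. w \<in> T \<Longrightarrow> L w = K w"
proof -
  have agree: "H w = K w" if "w \<in> S \<inter> T" for w
    using section_unique [OF G conn section_on_subset [OF S(2) Int_lower1]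
        section_on_subset [OF T(2) Int_lower2]] z that by blast
  define L where "L = (\<lambda>w. if w \<in> S then H w else K w)"
  have LS: "L w = H w" if "w \<in> S" for w using that L_def by auto
  have LT: "L w = K w" if "w \<in> T" for w using that L_def agree by auto
  have "continuous_on S L" using S LS unfolding section_on_def by (metis continuous_on_cong)
  moreover have "continuous_on T L" using T LT unfolding section_on_def by (metis continuous_on_cong)
  ultimately have "continuous_on (S \<union> T) L" using S T by (simp add: continuous_on_closed_Un)
  moreover have "\<forall>w\<in>S \<union> T. G (L w) = w" using LS LT S T unfolding section_on_def by auto
  ultimately show thesis using that LS LT unfolding section_on_def by blast
qed

lemma locally_injective_local_section:
  fixes G :: "'a::euclidean_space \<Rightarrow> 'a"
  assumes G: "locally_injective G" and cont: "continuous_on UNIV G"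
  obtains T \<rho> H where "open T" "x \<in> T" "\<rho> > 0" "G ` T \<subseteq> ball (G x) \<rho>"
    "section_on G (ball (G x) \<rho>) H" "\<And>y. y \<in> T \<Longrightarrow> H (G y) = y"
proof -
  obtain r where r: "r > 0" "inj_on G (ball x r)"
    using G unfolding locally_injective_def by blast
  have cb: "continuous_on (ball x r) G" using cont continuous_on_subset by blast
  have "open (G ` ball x r)" by (rule invariance_of_domain [OF cb open_ball r(2)])
  moreover have "G x \<in> G ` ball x r" using r by simp
  ultimately obtain \<rho> where \<rho>: "\<rho> > 0" "ball (G x) \<rho> \<subseteq> G ` ball x r"
    using open_contains_ball by blast
  define T where "T = ball x r \<inter> G -` ball (G x) \<rho>"
  have inv: "inv_into (ball x r) G (G y) = y" if "y \<in> ball x r" for y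
    using r that by simp
  have "section_on G (G ` ball x r) (inv_into (ball x r) G)"
    unfolding section_on_def
    using continuous_on_inverse_open [OF open_ball cb _ inv] by (auto simp: f_inv_into_f)
  then have sec: "section_on G (ball (G x) \<rho>) (inv_into (ball x r) G)"
    using \<rho>(2) section_on_subset by blast
  have "open T" unfolding T_def
    using cb by (intro continuous_open_preimage) auto
  moreover have "x \<in> T" "G ` T \<subseteq> ball (G x) \<rho>" using r \<rho>(1) unfolding T_def by auto
  moreover have "inv_into (ball x r) G (G y) = y" if "y \<in> T" for y
    using inv that unfolding T_def by blast
  ultimately show thesis using that [OF _ _ \<rho>(1) _ sec] by blast
qed

lemma convex_hull_triple_collinear:
  fixes u v w :: "'a::euclidean_space"
  assumes "collinear {u, v, w}"
  shows "convex hull {u, v, w} \<subseteq> closed_segment u v \<union> closed_segment v w"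
proof -
  have *: "convex hull {a, b, c} = closed_segment a c" if "b \<in> closed_segment a c" for a b c :: 'a
  proof -
    have "convex hull {a, b, c} = convex hull (insert b {a, c})" by (simp add: insert_commute)
    also have "\<dots> = convex hull {a, c}"
      using that by (metis hull_redundant segment_convex_hull)
    finally show ?thesis by (simp add: segment_convex_hull)
  qed
  consider "v \<in> closed_segment u w" | "u \<in> closed_segment v w" | "w \<in> closed_segment u v"
    using assms collinear_between_cases[of u v w] between_mem_segment
    by (metis between_commute)
  then show ?thesis
  proof cases
    case 1
    then show ?thesis using * Un_closed_segment by blast
  next
    case 2
    then show ?thesis using *[of u v w] by (metis insert_commute Un_upper2)
  next
    case 3
    then show ?thesis using *[of w u v] by (metis insert_commute Un_upper1)
  qed
qed

text \<open>Call \<open>y\<close> reachable from \<open>a\<close> if the segment from \<open>G a\<close> to \<open>G y\<close> carries a section that leads from \<open>a\<close>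
  to \<open>y\<close>. If every section over two sides of a triangle extended to the triangle, then its third side
  would show that reachability passes between nearby points, and by connectedness every point would be
  reachable. But a point \<open>b\<close> with \<open>G b = G a\<close> is reachable only over a degenerate segment, so \<open>b = a\<close>.\<close>

lemma unfillable_triangle:
  fixes G :: "'a::euclidean_space \<Rightarrow> 'a"
  assumes G: "locally_injective G" and cont: "continuous_on UNIV G" and "\<not> inj G"
  obtains u v w H where "\<not> collinear {u, v, w}"
    "section_on G (closed_segment v u \<union> closed_segment v w) H"
    "\<And>K. section_on G (convex hull {u, v, w}) K \<Longrightarrow> K v \<noteq> H v"
proof (rule ccontr)
  assume neg: "\<not> thesis"
  note fillable = that
  \<comment> \<open>Degenerate triangles are covered by their two sides, so only the others need the assumption.\<close>
  have fill: "\<exists>L. section_on G (closed_segment u w) L \<and> L u = H u \<and> L w = K w"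
    if H: "section_on G (closed_segment u v) H" and K: "section_on G (closed_segment v w) K"
      and eq: "H v = K v" for u v w H K
  proof -
    have "connected (closed_segment u v \<inter> closed_segment v w)"
      by (intro convex_connected convex_Int convex_closed_segment)
    then obtain M where M: "section_on G (closed_segment u v \<union> closed_segment v w) M"
      "\<And>z. z \<in> closed_segment u v \<Longrightarrow> M z = H z" "\<And>z. z \<in> closed_segment v w \<Longrightarrow> M z = K z"
      using section_glue [OF G closed_segment H closed_segment K, of v] eq by auto
    have "\<exists>L. section_on G (convex hull {u, v, w}) L \<and> L v = M v"
    proof (cases "collinear {u, v, w}")
      case True
      then show ?thesis
        using M(1) convex_hull_triple_collinear section_on_subset by blast
    next
      case False
      then show ?thesis
        using fillable [of u v w M] M(1) neg by (metis closed_segment_commute)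
    qed
    then obtain L where L: "section_on G (convex hull {u, v, w}) L" "L v = M v" by blast
    have uw: "closed_segment u w \<subseteq> convex hull {u, v, w}"
      "closed_segment u v \<subseteq> convex hull {u, v, w}" "closed_segment v w \<subseteq> convex hull {u, v, w}"
      unfolding segment_convex_hull by (intro hull_mono; blast)+
    have "L u = M u"
      by (rule section_unique [OF G connected_segment section_on_subset [OF L(1) uw(2)]
            section_on_subset [OF M(1) Un_upper1], of v u]) (use L in auto)
    moreover have "L w = M w"
      by (rule section_unique [OF G connected_segment section_on_subset [OF L(1) uw(3)]
            section_on_subset [OF M(1) Un_upper2], of v w]) (use L in auto)
    ultimately show ?thesis
      using section_on_subset [OF L(1) uw(1)] M(2,3) by (intro exI[of _ L]) auto
  qed
  have "inj G"
  proof (rule injI)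
    fix a b assume ab: "G a = G b"
    define P where "P y \<longleftrightarrow> (\<exists>H. section_on G (closed_segment (G a) (G y)) H \<and> H (G a) = a \<and> H (G y) = y)" for y
    have "P b"
    proof (rule connected_induction_simple [OF connected_UNIV, of a b P])
      show "P a" unfolding P_def section_on_def by (intro exI[of _ "\<lambda>_. a"]) simp
      fix x
      obtain T \<rho> H where T: "open T" "x \<in> T" "\<rho> > 0" "G ` T \<subseteq> ball (G x) \<rho>"
        "section_on G (ball (G x) \<rho>) H" "\<And>y. y \<in> T \<Longrightarrow> H (G y) = y"
        by (rule locally_injective_local_section [OF G cont, of x]) blast
      have "P z" if "y \<in> T" "z \<in> T" "P y" for y z
      proof -
        obtain K where K: "section_on G (closed_segment (G a) (G y)) K" "K (G a) = a" "K (G y) = y"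
          using \<open>P y\<close> unfolding P_def by blast
        have "closed_segment (G y) (G z) \<subseteq> ball (G x) \<rho>"
          using T(4) that convex_ball by (intro closed_segment_subset) auto
        then have "section_on G (closed_segment (G y) (G z)) H" using T(5) section_on_subset by blast
        from fill [OF K(1) this] show ?thesis
          unfolding P_def using K T(6) that by metis
      qed
      then show "\<exists>T. openin (top_of_set UNIV) T \<and> x \<in> T \<and> (\<forall>x\<in>T. \<forall>y\<in>T. P x \<longrightarrow> P y)"
        using T(1,2) by (metis open_openin subtopology_UNIV)
    qed auto
    then show "a = b" unfolding P_def using ab by auto
  qed
  then show False using \<open>\<not> inj G\<close> by blast
qed

section \<open>Curves above a line\<close>

text \<open>The vertical legs lead to height \<open>-1\<close>, the bottom side of the box in which the Fashoda theorem is
  applied.\<close>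

definition grounded_arc :: "(real \<Rightarrow> real ^ 2) \<Rightarrow> real \<Rightarrow> real \<Rightarrow> real \<Rightarrow> real ^ 2" where
  "grounded_arc \<gamma> u v =
     linepath (vector [\<gamma> u $ 1, -1]) (\<gamma> u) +++ (\<lambda>t. \<gamma> (u + t * (v - u))) +++
     linepath (\<gamma> v) (vector [\<gamma> v $ 1, -1])"

lemma
  fixes \<gamma> :: "real \<Rightarrow> real ^ 2"
  assumes uv: "u \<le> v" and cont: "continuous_on {u..v} \<gamma>"
    and nonneg: "\<forall>p\<in>{u..v}. 0 \<le> \<gamma> p $ 2"
  shows path_grounded_arc: "path (grounded_arc \<gamma> u v)"
    and grounded_arc_ends: "pathstart (grounded_arc \<gamma> u v) = vector [\<gamma> u $ 1, -1]"
      "pathfinish (grounded_arc \<gamma> u v) = vector [\<gamma> v $ 1, -1]"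
    and grounded_arc_cases: "z \<in> path_image (grounded_arc \<gamma> u v) \<Longrightarrow>
      (z $ 1 = \<gamma> u $ 1 \<and> -1 \<le> z $ 2 \<and> z $ 2 \<le> \<gamma> u $ 2) \<or> z \<in> \<gamma> ` {u..v} \<or>
      (z $ 1 = \<gamma> v $ 1 \<and> -1 \<le> z $ 2 \<and> z $ 2 \<le> \<gamma> v $ 2)"
proof -
  let ?m = "\<lambda>t. \<gamma> (u + t * (v - u))"
  have mem: "u + t * (v - u) \<in> {u..v}" if "t \<in> {0..1}" for t
    using that uv mult_right_mono[of t 1 "v - u"] by auto
  have pm: "path ?m"
    unfolding path_def
    by (rule continuous_on_compose2 [OF cont]) (use mem in \<open>auto intro!: continuous_intros\<close>)
  have ends: "pathstart ?m = \<gamma> u" "pathfinish ?m = \<gamma> v"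
    by (simp_all add: pathstart_def pathfinish_def)
  show "path (grounded_arc \<gamma> u v)"
    unfolding grounded_arc_def using pm ends by (intro path_join_imp) auto
  show "pathstart (grounded_arc \<gamma> u v) = vector [\<gamma> u $ 1, -1]"
      "pathfinish (grounded_arc \<gamma> u v) = vector [\<gamma> v $ 1, -1]"
    unfolding grounded_arc_def by simp_all
  have seg: "z $ 1 = x $ 1 \<and> -1 \<le> z $ 2 \<and> z $ 2 \<le> x $ 2"
    if zs: "z \<in> closed_segment (vector [x $ 1, -1]) x" and x2: "0 \<le> x $ 2" for z x :: "real ^ 2"
  proof -
    obtain t where t: "0 \<le> t" "t \<le> 1" "z = (1 - t) *\<^sub>R vector [x $ 1, -1] + t *\<^sub>R x"
      using zs unfolding in_segment(1) by blast
    have "z $ 2 = (1 - t) * (-1) + t * x $ 2" "z $ 1 = (1 - t) * x $ 1 + t * x $ 1"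
      unfolding t(3) by simp_all
    then have "z $ 2 = -1 + t * (x $ 2 + 1)" "z $ 1 = x $ 1" by (simp_all add: algebra_simps)
    moreover have "t * (x $ 2 + 1) \<le> x $ 2 + 1" "0 \<le> t * (x $ 2 + 1)"
      using t x2 by (simp_all add: mult_left_le_one_le)
    ultimately show ?thesis by simp
  qed
  assume z: "z \<in> path_image (grounded_arc \<gamma> u v)"
  have "path_image (grounded_arc \<gamma> u v) \<subseteq> closed_segment (vector [\<gamma> u $ 1, -1]) (\<gamma> u)
      \<union> (path_image ?m \<union> closed_segment (\<gamma> v) (vector [\<gamma> v $ 1, -1]))"
    unfolding grounded_arc_def path_image_linepath [symmetric]
    by (rule order_trans [OF path_image_join_subset Un_mono [OF order_refl path_image_join_subset]])
  moreover have "path_image ?m \<subseteq> \<gamma> ` {u..v}" unfolding path_image_def using mem by blast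
  ultimately consider "z \<in> closed_segment (vector [\<gamma> u $ 1, -1]) (\<gamma> u)" | "z \<in> \<gamma> ` {u..v}"
    | "z \<in> closed_segment (vector [\<gamma> v $ 1, -1]) (\<gamma> v)"
    using z closed_segment_commute by blast
  then show "(z $ 1 = \<gamma> u $ 1 \<and> -1 \<le> z $ 2 \<and> z $ 2 \<le> \<gamma> u $ 2) \<or> z \<in> \<gamma> ` {u..v} \<or>
      (z $ 1 = \<gamma> v $ 1 \<and> -1 \<le> z $ 2 \<and> z $ 2 \<le> \<gamma> v $ 2)"
    using seg[of z "\<gamma> u"] seg[of z "\<gamma> v"] nonneg uv by cases simp_all
qed

text \<open>The curve stays above the horizontal axis, touches it at three points from left to right, and at
  the middle contact \<open>p2\<close> it moves to the left. Cut it shortly before and shortly after \<open>p2\<close>. The first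
  piece then ends to the right of the point where the second piece starts, so that the ends of the two
  pieces interlace on the axis, and the pieces cross.\<close>

lemma no_backward_contact:
  fixes \<gamma> :: "real \<Rightarrow> real ^ 2"
  assumes p: "p1 < p2" "p2 < p3"
    and cont: "continuous_on {p1..p3} \<gamma>" and inj: "inj_on \<gamma> {p1..p3}"
    and nonneg: "\<And>p. p \<in> {p1..p3} \<Longrightarrow> 0 \<le> \<gamma> p $ 2"
    and zero: "\<gamma> p1 $ 2 = 0" "\<gamma> p2 $ 2 = 0" "\<gamma> p3 $ 2 = 0"
    and order: "\<gamma> p1 $ 1 < \<gamma> p2 $ 1" "\<gamma> p2 $ 1 < \<gamma> p3 $ 1"
    and der: "((\<lambda>p. \<gamma> p $ 1) has_real_derivative d) (at p2)" "d < 0"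
  shows False
proof -
  obtain e1 where e1: "e1 > 0" "\<And>h. 0 < h \<Longrightarrow> h < e1 \<Longrightarrow> \<gamma> (p2 + h) $ 1 < \<gamma> p2 $ 1"
    using DERIV_neg_dec_right [OF der] by blast
  obtain e2 where e2: "e2 > 0" "\<And>h. 0 < h \<Longrightarrow> h < e2 \<Longrightarrow> \<gamma> p2 $ 1 < \<gamma> (p2 - h) $ 1"
    using DERIV_neg_dec_left [OF der] by blast
  define M where "M = min (min e1 e2) (min (p2 - p1) (p3 - p2))"
  have M: "0 < M" "M \<le> e1" "M \<le> e2" "M \<le> p2 - p1" "M \<le> p3 - p2"
    unfolding M_def using e1(1) e2(1) p by simp_all
  define e where "e = M / 2"
  have e: "0 < e" "e < e1" "e < e2" "p1 < p2 - e" "p2 + e < p3"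
    unfolding e_def using M by simp_all
  have right: "\<gamma> q $ 1 < \<gamma> p2 $ 1" if "p2 < q" "q \<le> p2 + e" for q
    using e1(2)[of "q - p2"] that e by simp
  have left: "\<gamma> p2 $ 1 < \<gamma> q $ 1" if "q < p2" "p2 - e \<le> q" for q
    using e2(2)[of "p2 - q"] that e by simp
  define Far where "Far = \<gamma> ` ({p1..p2 - e} \<union> {p2 + e..p3})"
  have sub: "{p1..p2 - e} \<union> {p2 + e..p3} \<subseteq> {p1..p3}" using e p by auto
  \<comment> \<open>The distance to the remote part of the curve bounds how far the vertical legs at the cuts may reach.\<close>
  have "compact Far"
    unfolding Far_def using continuous_on_subset [OF cont sub]
    by (intro compact_continuous_image compact_Un) auto
  moreover have "\<gamma> p2 \<notin> Far"
  proof
    assume "\<gamma> p2 \<in> Far"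
    then obtain q where q: "\<gamma> p2 = \<gamma> q" "q \<in> {p1..p2 - e} \<union> {p2 + e..p3}"
      unfolding Far_def by (rule imageE)
    then have "p2 = q" using inj_onD [OF inj q(1)] sub p by auto
    then show False using q e by auto
  qed
  ultimately obtain \<rho> where \<rho>: "\<rho> > 0" "\<And>z. z \<in> Far \<Longrightarrow> \<rho> \<le> dist (\<gamma> p2) z"
    using separate_point_closed [of Far "\<gamma> p2"] compact_imp_closed by blast
  obtain \<delta> where \<delta>: "\<delta> > 0"
    "\<And>q. q \<in> {p1..p3} \<Longrightarrow> dist q p2 < \<delta> \<Longrightarrow> dist (\<gamma> q) (\<gamma> p2) < \<rho>"
    using cont p \<rho>(1) unfolding continuous_on_iff by (metis atLeastAtMost_iff less_imp_le)
  define h where "h = min e (\<delta> / 2)"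
  have h: "0 < h" "h \<le> e" "h < \<delta>" unfolding h_def using e \<delta>(1) by auto
  define a b where "a = p2 - h" and "b = p2 + h"
  have ab: "p1 < a" "a < p2" "p2 < b" "b < p3" unfolding a_def b_def using h e by auto
  have da: "dist (\<gamma> a) (\<gamma> p2) < \<rho>" and db: "dist (\<gamma> b) (\<gamma> p2) < \<rho>"
    using ab p h by (auto intro!: \<delta>(2) simp: a_def b_def dist_real_def)
  have l1: "dist x y \<le> \<bar>x $ 1 - y $ 1\<bar> + \<bar>x $ 2 - y $ 2\<bar>" for x y :: "real ^ 2"
    using norm_le_l1_cart[of "x - y"] by (simp add: dist_norm sum_2)
  have "\<gamma> p1 \<in> Far" "\<gamma> p3 \<in> Far" unfolding Far_def using e by auto
  then have gap: "\<rho> \<le> \<gamma> p2 $ 1 - \<gamma> p1 $ 1" "\<rho> \<le> \<gamma> p3 $ 1 - \<gamma> p2 $ 1"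
    using \<rho>(2)[of "\<gamma> p1"] \<rho>(2)[of "\<gamma> p3"] l1[of "\<gamma> p2" "\<gamma> p1"] l1[of "\<gamma> p2" "\<gamma> p3"] zero order
    by auto
  have a1: "\<gamma> p2 $ 1 < \<gamma> a $ 1" "\<gamma> a $ 1 < \<gamma> p3 $ 1"
    using left[of a] ab h gap da dist_vec_nth_le[of "\<gamma> a" 1 "\<gamma> p2"]
    by (auto simp: a_def dist_real_def)
  have b1: "\<gamma> b $ 1 < \<gamma> p2 $ 1" "\<gamma> p1 $ 1 < \<gamma> b $ 1"
    using right[of b] ab h gap db dist_vec_nth_le[of "\<gamma> b" 1 "\<gamma> p2"]
    by (auto simp: b_def dist_real_def)
  have below: "dist z (\<gamma> p2) \<le> dist c (\<gamma> p2)" if "z $ 1 = c $ 1" "0 \<le> z $ 2" "z $ 2 \<le> c $ 2"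
    for z c :: "real ^ 2"
    unfolding dist_norm
  proof (rule norm_le_componentwise_cart)
    fix i :: 2
    show "norm ((z - \<gamma> p2) $ i) \<le> norm ((c - \<gamma> p2) $ i)"
      using exhaust_2[of i] that zero by auto
  qed
  have near: "q \<notin> {p1..p2 - e} \<union> {p2 + e..p3}" if "dist (\<gamma> q) (\<gamma> p2) < \<rho>" for q
    using \<rho>(2)[of "\<gamma> q"] that unfolding Far_def by (auto simp: dist_commute)
  define f g where "f = grounded_arc \<gamma> p1 a" and "g = grounded_arc \<gamma> b p3"
  have ca: "continuous_on {p1..a} \<gamma>" and cb: "continuous_on {b..p3} \<gamma>"
    using continuous_on_subset [OF cont] ab by auto
  have na: "\<forall>q\<in>{p1..a}. 0 \<le> \<gamma> q $ 2" and nb: "\<forall>q\<in>{b..p3}. 0 \<le> \<gamma> q $ 2"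
    using nonneg ab by auto
  note fp = path_grounded_arc [OF less_imp_le [OF ab(1)] ca na]
    grounded_arc_ends [OF less_imp_le [OF ab(1)] ca na]
    grounded_arc_cases [OF less_imp_le [OF ab(1)] ca na]
  note gp = path_grounded_arc [OF less_imp_le [OF ab(4)] cb nb]
    grounded_arc_ends [OF less_imp_le [OF ab(4)] cb nb]
    grounded_arc_cases [OF less_imp_le [OF ab(4)] cb nb]
  have "bounded (\<gamma> ` {p1..p3})"
    by (intro compact_imp_bounded compact_continuous_image cont) auto
  then obtain R where R: "\<And>q. q \<in> {p1..p3} \<Longrightarrow> norm (\<gamma> q) \<le> R" unfolding bounded_iff by (metis imageI)
  have R': "\<bar>\<gamma> q $ i\<bar> \<le> R" if "q \<in> {p1..p3}" for q i
    using R[OF that] component_le_norm_cart[of "\<gamma> q" i] by linarith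
  have Ri: "-R \<le> \<gamma> q $ 1 \<and> \<gamma> q $ 1 \<le> R \<and> \<gamma> q $ 2 \<le> R \<and> 0 \<le> \<gamma> q $ 2" if "q \<in> {p1..p3}" for q
    using R'[OF that, of 1] R'[OF that, of 2] nonneg[OF that] by (simp add: abs_le_iff)
  have box: "z \<in> cbox (vector [-R, -1]) (vector [R, R])"
    if "(z $ 1 = \<gamma> u $ 1 \<and> -1 \<le> z $ 2 \<and> z $ 2 \<le> \<gamma> u $ 2) \<or> z \<in> \<gamma> ` {u..v} \<or>
      (z $ 1 = \<gamma> v $ 1 \<and> -1 \<le> z $ 2 \<and> z $ 2 \<le> \<gamma> v $ 2)" and uv: "p1 \<le> u" "u \<le> v" "v \<le> p3" for z u v
  proof -
    have "-R \<le> z $ 1 \<and> z $ 1 \<le> R \<and> -1 \<le> z $ 2 \<and> z $ 2 \<le> R"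
      using that(1)
    proof (elim disjE)
      assume "z \<in> \<gamma> ` {u..v}"
      then obtain q where q: "z = \<gamma> q" "q \<in> {u..v}" by (rule imageE)
      then have "q \<in> {p1..p3}" using uv by simp
      then show ?thesis using Ri[of q] q by simp
    qed (use Ri[of u] Ri[of v] uv in auto)
    then show ?thesis by (simp add: mem_box_cart forall_2)
  qed
  obtain z where zf: "z \<in> path_image f" and zg: "z \<in> path_image g"
  proof (rule fashoda_interlace [of f g "vector [-R, -1]" "vector [R, R]"])
    show "path f" "path g" unfolding f_def g_def using fp(1) gp(1) .
    show "path_image f \<subseteq> cbox (vector [-R, -1]) (vector [R, R])"
      using box[OF fp(4)] ab unfolding f_def by (auto simp: less_imp_le)
    show "path_image g \<subseteq> cbox (vector [-R, -1]) (vector [R, R])"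
      using box[OF gp(4)] ab p unfolding g_def by (auto simp: less_imp_le)
  qed (use fp(2,3) gp(2,3) a1 b1 in \<open>auto simp: f_def g_def\<close>)
  have same: "q = r" if "\<gamma> q = \<gamma> r" "q \<in> {p1..p3}" "r \<in> {p1..p3}" for q r
    using inj_onD [OF inj that] .
  have eqI: "x = y" if "x $ 1 = y $ 1" "x $ 2 = y $ 2" for x y :: "real ^ 2"
    using that by (simp add: vec_eq_iff forall_2)
  consider (f1) "z $ 1 = \<gamma> p1 $ 1" "z $ 2 \<le> 0" | (f2) q where "q \<in> {p1..a}" "z = \<gamma> q"
    | (f3) "z $ 1 = \<gamma> a $ 1" "z $ 2 \<le> \<gamma> a $ 2"
    using fp(4)[of z] zf zero unfolding f_def by auto
  note fcases = this
  consider (g1) "z $ 1 = \<gamma> b $ 1" "z $ 2 \<le> \<gamma> b $ 2" | (g2) q where "q \<in> {b..p3}" "z = \<gamma> q"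
    | (g3) "z $ 1 = \<gamma> p3 $ 1" "z $ 2 \<le> 0"
    using gp(4)[of z] zg zero unfolding g_def by auto
  then show False
  proof cases
    case g1
    from fcases show False
    proof cases
      case (f2 q)
      have "0 \<le> z $ 2" using f2 na by simp
      then have "dist z (\<gamma> p2) < \<rho>" using below[OF g1(1) _ g1(2)] db by linarith
      then have "dist (\<gamma> q) (\<gamma> p2) < \<rho>" unfolding f2(2) .
      then have "p2 - e < q" using near[of q] f2 ab by auto
      then have "\<gamma> p2 $ 1 < \<gamma> q $ 1" using left[of q] f2 ab by auto
      then show False using g1 f2 b1 by simp
    qed (use g1 a1 b1 in auto)
  next
    case (g2 q)
    have q: "q \<in> {p1..p3}" using g2 ab by auto
    from fcases show False
    proof cases
      case f1
      then have "\<gamma> q = \<gamma> p1" using g2 nonneg[OF q] zero by (intro eqI) auto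
      then have "q = p1" using same q ab p by simp
      then show False using g2 ab by simp
    next
      case (f2 r)
      then have "\<gamma> q = \<gamma> r" "r \<in> {p1..p3}" using g2 ab by simp_all
      then have "q = r" using same q by blast
      then show False using f2 g2 ab by simp
    next
      case f3
      have "0 \<le> z $ 2" using g2 nb by simp
      then have "dist z (\<gamma> p2) < \<rho>" using below[OF f3(1) _ f3(2)] da by linarith
      then have "dist (\<gamma> q) (\<gamma> p2) < \<rho>" unfolding g2(2) .
      then have "q < p2 + e" using near[of q] g2 ab by auto
      then have "\<gamma> q $ 1 < \<gamma> p2 $ 1" using right[of q] g2 ab by auto
      then show False using g2 f3 a1 by simp
    qed
  next
    case g3
    from fcases show False
    proof cases
      case (f2 q)
      then have "0 \<le> z $ 2" using na by simp
      then have "\<gamma> q = \<gamma> p3" using g3 zero f2 by (intro eqI) auto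
      then have "q = p3" using same f2 ab p by simp
      then show False using f2 ab by simp
    qed (use g3 a1 b1 order in auto)
  qed
qed

section \<open>Auxiliary calculus\<close>

lemma continuous_on_vector_2:
  assumes "continuous_on S f" "continuous_on S g"
  shows "continuous_on S (\<lambda>p. vector [f p, g p] :: real ^ 2)"
proof -
  have eq: "(vector [x, y] :: real ^ 2) = x *\<^sub>R axis 1 1 + y *\<^sub>R axis 2 1" for x y
    by (simp add: vec_eq_iff forall_2 axis_def)
  show ?thesis unfolding eq using assms by (intro continuous_intros)
qed

lemma last_crossing:
  fixes f :: "real \<Rightarrow> real"
  assumes uv: "u \<le> v" and cont: "continuous_on {u..v} f" and fu: "N \<le> f u" and fv: "f v \<le> N"
  obtains s where "u \<le> s" "s \<le> v" "f s = N" "\<And>t. s \<le> t \<Longrightarrow> t \<le> v \<Longrightarrow> f t \<le> N"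
proof -
  define S where "S = {u..v} \<inter> f -` {N}"
  have "\<exists>x. u \<le> x \<and> x \<le> v \<and> f x = N" by (rule IVT2' [OF fv fu uv cont])
  then have "S \<noteq> {}" unfolding S_def by auto
  moreover have "compact S"
    unfolding compact_eq_bounded_closed
  proof
    show "closed S" unfolding S_def
      by (rule continuous_closed_preimage [OF cont closed_atLeastAtMost closed_singleton])
    show "bounded S" unfolding S_def by (rule bounded_subset [OF bounded_closed_interval Int_lower1])
  qed
  ultimately obtain s where s: "s \<in> S" "\<And>t. t \<in> S \<Longrightarrow> t \<le> s"
    using compact_attains_sup [of S] by blast
  have sS: "u \<le> s" "s \<le> v" "f s = N" using s(1) unfolding S_def by auto
  have "f t \<le> N" if t: "s \<le> t" "t \<le> v" for t
  proof (rule ccontr)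
    assume "\<not> f t \<le> N"
    then have ft: "N \<le> f t" "N < f t" by auto
    have "continuous_on {t..v} f" by (rule continuous_on_subset [OF cont]) (use sS t in auto)
    from IVT2' [OF fv ft(1) t(2) this] obtain x where x: "t \<le> x" "x \<le> v" "f x = N" by auto
    then have "x \<in> S" using sS t unfolding S_def by auto
    then have "x = t" using s(2)[of x] x t by auto
    then show False using ft x by simp
  qed
  then show thesis using that sS by blast
qed

lemma first_crossing:
  fixes f :: "real \<Rightarrow> real"
  assumes uv: "u \<le> v" and cont: "continuous_on {u..v} f" and fu: "f u \<le> N" and fv: "N \<le> f v"
  obtains s where "u \<le> s" "s \<le> v" "f s = N" "\<And>t. u \<le> t \<Longrightarrow> t \<le> s \<Longrightarrow> f t \<le> N"
proof -
  have c: "continuous_on {-v..-u} (\<lambda>t. f (- t))"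
    by (rule continuous_on_compose2 [OF cont]) (auto intro!: continuous_intros)
  obtain s where s: "-v \<le> s" "s \<le> -u" "f (- s) = N" "\<And>t. s \<le> t \<Longrightarrow> t \<le> -u \<Longrightarrow> f (- t) \<le> N"
    by (rule last_crossing [of "-v" "-u" "\<lambda>t. f (- t)" N]) (use uv c fu fv in auto)
  have "f t \<le> N" if "u \<le> t" "t \<le> -s" for t using s(4)[of "-t"] that by simp
  then show thesis using that[of "-s"] s by simp
qed

lemma feasible_direction_derivative_le:
  fixes f :: "'a::real_normed_vector \<Rightarrow> real"
  assumes f: "(f has_derivative f') (at w)"
    and e: "e > 0" "\<And>t. 0 < t \<Longrightarrow> t < e \<Longrightarrow> f (w + t *\<^sub>R d) \<le> f w"
  shows "f' d \<le> 0"
proof (rule ccontr)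
  assume "\<not> f' d \<le> 0"
  then have pos: "0 < f' d" by simp
  interpret f': bounded_linear f' by (rule has_derivative_bounded_linear [OF f])
  have "((\<lambda>t::real. w + t *\<^sub>R d) has_derivative (\<lambda>t. t *\<^sub>R d)) (at 0)"
    by (auto intro!: derivative_eq_intros)
  moreover have "(f has_derivative f') (at (w + 0 *\<^sub>R d))" using f by simp
  ultimately have "((\<lambda>t. f (w + t *\<^sub>R d)) has_derivative (\<lambda>t. f' (t *\<^sub>R d))) (at 0)"
    using diff_chain_at [of "\<lambda>t::real. w + t *\<^sub>R d" "\<lambda>t. t *\<^sub>R d" 0 f f'] by (simp add: o_def)
  then have "((\<lambda>t. f (w + t *\<^sub>R d)) has_real_derivative f' d) (at 0)"
    by (simp add: has_field_derivative_def f'.scaleR mult_commute_abs)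
  from DERIV_pos_inc_right [OF this pos]
  obtain r where r: "r > 0" "\<And>t. 0 < t \<Longrightarrow> t < r \<Longrightarrow> f w < f (w + t *\<^sub>R d)" by auto
  have "0 < min r e / 2" "min r e / 2 < r" "min r e / 2 < e" using r(1) e(1) by auto
  then show False using r(2)[of "min r e / 2"] e(2)[of "min r e / 2"] by linarith
qed

text \<open>The hypotheses say that the row vector \<open>(b, 1)\<close> is a left eigenvector of \<open>N\<close> with eigenvalue \<open>c\<close>;
  hence it is one of the inverse matrix \<open>J\<close> with eigenvalue \<open>1/c\<close>.\<close>

lemma left_eigenvector_of_inverse:
  fixes N J :: "real ^ 2 ^ 2"
  assumes NJ: "N ** J = mat 1" and "c \<noteq> 0"
    and eig: "b * N $ 1 $ 1 + N $ 2 $ 1 = c * b" "b * N $ 1 $ 2 + N $ 2 $ 2 = c"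
  shows "det (J - mat (1 / c)) = 0"
proof -
  have id: "(N ** J) $ i $ j = (if i = j then 1 else 0)" for i j
    unfolding NJ by (simp add: mat_def)
  have e: "N $ 1 $ 1 * J $ 1 $ 1 + N $ 1 $ 2 * J $ 2 $ 1 = 1"
    "N $ 1 $ 1 * J $ 1 $ 2 + N $ 1 $ 2 * J $ 2 $ 2 = 0"
    "N $ 2 $ 1 * J $ 1 $ 1 + N $ 2 $ 2 * J $ 2 $ 1 = 0"
    "N $ 2 $ 1 * J $ 1 $ 2 + N $ 2 $ 2 * J $ 2 $ 2 = 1"
    using id[of 1 1] id[of 1 2] id[of 2 1] id[of 2 2]
    by (simp_all add: matrix_matrix_mult_def sum_2)
  have "b = (b * N $ 1 $ 1 + N $ 2 $ 1) * J $ 1 $ 1 + (b * N $ 1 $ 2 + N $ 2 $ 2) * J $ 2 $ 1"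
    using e(1,3) by algebra
  then have 1: "b = c * (b * J $ 1 $ 1 + J $ 2 $ 1)" unfolding eig by (simp add: algebra_simps)
  have "1 = (b * N $ 1 $ 1 + N $ 2 $ 1) * J $ 1 $ 2 + (b * N $ 1 $ 2 + N $ 2 $ 2) * J $ 2 $ 2"
    using e(2,4) by algebra
  then have 2: "1 = c * (b * J $ 1 $ 2 + J $ 2 $ 2)" unfolding eig by (simp add: algebra_simps)
  have "J $ 2 $ 2 - 1 / c = - (b * J $ 1 $ 2)" "J $ 2 $ 1 = - (b * (J $ 1 $ 1 - 1 / c))"
    using 1 2 \<open>c \<noteq> 0\<close> by (simp_all add: field_simps)
  then show ?thesis by (simp add: det_2 mat_def)
qed

section \<open>Maps with positive Jacobian determinant\<close>

locale positive_jacobian =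
  fixes G :: "real ^ 2 \<Rightarrow> real ^ 2" and J :: "real ^ 2 \<Rightarrow> real ^ 2 ^ 2"
  assumes deriv: "\<And>x. (G has_derivative (\<lambda>h. J x *v h)) (at x)"
    and cont_J: "continuous_on UNIV J"
    and det_pos: "\<And>x. 0 < det (J x)"
begin

lemma cont_G: "continuous_on UNIV G"
  using deriv has_derivative_continuous by (blast intro: continuous_at_imp_continuous_on)

lemma inverse_jacobian: "matrix_inv (J x) ** J x = mat 1" "J x ** matrix_inv (J x) = mat 1"
proof -
  have "invertible (J x)" using det_pos[of x] by (simp add: invertible_det_nz)
  then show "matrix_inv (J x) ** J x = mat 1" "J x ** matrix_inv (J x) = mat 1"
    using someI_ex [of "\<lambda>N. J x ** N = mat 1 \<and> N ** J x = mat 1"]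
    unfolding matrix_inv_def invertible_def by blast+
qed

lemma locally_injective_G: "locally_injective G"
  unfolding locally_injective_def
proof
  fix a
  obtain r where "r > 0" "ball a r \<subseteq> UNIV" "inj_on G (ball a r)"
  proof (rule has_derivative_locally_injective
      [of a UNIV "\<lambda>h. matrix_inv (J a) *v h" "\<lambda>x h. J x *v h" G])
    show "bounded_linear (\<lambda>h. matrix_inv (J a) *v h)"
      by (rule matrix_vector_mul_bounded_linear)
    show "(\<lambda>h. matrix_inv (J a) *v h) \<circ> (\<lambda>h. J a *v h) = id"
      by (simp add: fun_eq_iff matrix_vector_mul_assoc inverse_jacobian)
    fix e :: real assume e: "e > 0"
    have "isCont J a" using cont_J by (simp add: continuous_on_eq_continuous_at)
    then obtain d where d: "d > 0" "\<And>x. dist x a < d \<Longrightarrow> dist (J x) (J a) < e / 5"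
      unfolding continuous_at_eps_delta using e by (metis zero_less_divide_iff zero_less_numeral)
    have "onorm (\<lambda>v. J x *v v - J a *v v) < e" if "dist a x < d" for x
    proof -
      have "(\<lambda>v. J x *v v - J a *v v) = (*v) (J x - J a)"
        by (simp add: fun_eq_iff matrix_vector_mult_diff_rdistrib)
      then have "onorm (\<lambda>v. J x *v v - J a *v v) \<le> (\<Sum>i\<in>UNIV. \<Sum>j\<in>UNIV. \<bar>(J x - J a) $ i $ j\<bar>)"
        using onorm_le_matrix_component_sum[of "J x - J a"] by simp
      also have "\<dots> \<le> (\<Sum>i\<in>(UNIV::2 set). \<Sum>j\<in>(UNIV::2 set). norm (J x - J a))"
      proof (intro sum_mono)
        fix i j :: 2
        have "\<bar>(J x - J a) $ i $ j\<bar> \<le> norm ((J x - J a) $ i)" by (rule component_le_norm_cart)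
        also have "\<dots> \<le> norm (J x - J a)" by (rule Finite_Cartesian_Product.norm_nth_le)
        finally show "\<bar>(J x - J a) $ i $ j\<bar> \<le> norm (J x - J a)" .
      qed
      also have "\<dots> = 4 * dist (J x) (J a)" by (simp add: dist_norm)
      also have "\<dots> < e" using d(2)[of x] that e by (simp add: dist_commute)
      finally show ?thesis .
    qed
    then show "\<exists>d>0. \<forall>x. dist a x < d \<longrightarrow> onorm (\<lambda>v. J x *v v - J a *v v) < e"
      using d(1) by blast
  qed (use deriv in auto)
  then show "\<exists>r>0. inj_on G (ball a r)" by blast
qed

lemma section_has_derivative:
  assumes "open U" "section_on G U H" "w \<in> U"
  shows "(H has_derivative (\<lambda>h. matrix_inv (J (H w)) *v h)) (at w)"
proof (rule has_derivative_inverse_basic [of G "\<lambda>h. J (H w) *v h" H w _ U])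
  show "(G has_derivative (\<lambda>h. J (H w) *v h)) (at (H w))" by (rule deriv)
  show "bounded_linear (\<lambda>h. matrix_inv (J (H w)) *v h)"
    by (rule matrix_vector_mul_bounded_linear)
  show "(\<lambda>h. matrix_inv (J (H w)) *v h) \<circ> (\<lambda>h. J (H w) *v h) = id"
    by (simp add: fun_eq_iff matrix_vector_mul_assoc inverse_jacobian)
  show "continuous (at w) H"
    using assms unfolding section_on_def by (simp add: continuous_on_eq_continuous_at)
qed (use assms in \<open>auto simp: section_on_def\<close>)

lemma inverse_jacobian_bounded:
  obtains L where "\<And>x. norm x \<le> B \<Longrightarrow> onorm (\<lambda>h. matrix_inv (J x) *v h) \<le> L"
proof -
  have cJ: "continuous_on (cball 0 B) (\<lambda>x. J x $ i $ j)" for i j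
    using continuous_on_subset [OF cont_J subset_UNIV] by (intro continuous_intros)
  define S where "S x = \<bar>J x $ 1 $ 1\<bar> + \<bar>J x $ 1 $ 2\<bar> + \<bar>J x $ 2 $ 1\<bar> + \<bar>J x $ 2 $ 2\<bar>" for x
  have "continuous_on (cball 0 B) (\<lambda>x. S x / det (J x))"
    unfolding S_def det_2 using det_pos
    by (intro continuous_intros cJ) (metis det_2 less_irrefl)
  then have "bounded ((\<lambda>x. S x / det (J x)) ` cball 0 B)"
    by (intro compact_imp_bounded compact_continuous_image) auto
  then obtain L where L: "\<And>x. x \<in> cball 0 B \<Longrightarrow> norm (S x / det (J x)) \<le> L"
    unfolding bounded_iff by (metis imageI)
  have "onorm (\<lambda>h. matrix_inv (J x) *v h) \<le> L" if "norm x \<le> B" for x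
  proof -
    define N where "N = matrix_inv (J x)"
    have id: "(N ** J x) $ i $ j = (if i = j then 1 else 0)" for i j
      unfolding N_def inverse_jacobian by (simp add: mat_def)
    have e: "N $ 1 $ 1 * J x $ 1 $ 1 + N $ 1 $ 2 * J x $ 2 $ 1 = 1"
      "N $ 1 $ 1 * J x $ 1 $ 2 + N $ 1 $ 2 * J x $ 2 $ 2 = 0"
      "N $ 2 $ 1 * J x $ 1 $ 1 + N $ 2 $ 2 * J x $ 2 $ 1 = 0"
      "N $ 2 $ 1 * J x $ 1 $ 2 + N $ 2 $ 2 * J x $ 2 $ 2 = 1"
      using id[of 1 1] id[of 1 2] id[of 2 1] id[of 2 2]
      by (simp_all add: matrix_matrix_mult_def sum_2)
    have d: "0 < det (J x)" by (rule det_pos)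
    have "N $ 1 $ 1 * det (J x) = J x $ 2 $ 2" "N $ 1 $ 2 * det (J x) = - J x $ 1 $ 2"
      "N $ 2 $ 1 * det (J x) = - J x $ 2 $ 1" "N $ 2 $ 2 * det (J x) = J x $ 1 $ 1"
      unfolding det_2 using e by algebra+
    then have N: "N $ 1 $ 1 = J x $ 2 $ 2 / det (J x)" "N $ 1 $ 2 = - J x $ 1 $ 2 / det (J x)"
      "N $ 2 $ 1 = - J x $ 2 $ 1 / det (J x)" "N $ 2 $ 2 = J x $ 1 $ 1 / det (J x)"
      using d by (simp_all add: field_simps)
    have "onorm (\<lambda>h. N *v h) \<le> (\<Sum>i\<in>UNIV. \<Sum>j\<in>UNIV. \<bar>N $ i $ j\<bar>)"
      using onorm_le_matrix_component_sum[of N] by simp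
    also have "\<dots> = S x / det (J x)"
      unfolding sum_2 N S_def using d by (simp add: add_divide_distrib)
    also have "\<dots> \<le> norm (S x / det (J x))" unfolding real_norm_def by (rule abs_ge_self)
    also have "\<dots> \<le> L" using L[of x] that by (simp del: norm_divide)
    finally show ?thesis unfolding N_def .
  qed
  then show thesis using that by blast
qed

end

locale real_spectral_gap = positive_jacobian +
  fixes \<delta> :: real
  assumes gap_pos: "0 < \<delta>"
    and gap: "\<And>x \<mu>. \<bar>\<mu>\<bar> < \<delta> \<Longrightarrow> det (J x - mat \<mu>) \<noteq> 0"

section \<open>Sweeping a wedge by parallel lines\<close>

definition axes :: "(real ^ 2) set" where
  "axes = {w. 0 \<le> w $ 1 \<and> w $ 1 \<le> 1 \<and> 0 \<le> w $ 2 \<and> w $ 2 \<le> 1 \<and> (w $ 1 = 0 \<or> w $ 2 = 0)}"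

definition wedge :: "real \<Rightarrow> real \<Rightarrow> (real ^ 2) set" where
  "wedge b l = {w. 0 \<le> w $ 1 \<and> 0 \<le> w $ 2 \<and> w $ 2 + b * w $ 1 \<le> l}"

lemma closed_axes: "closed axes"
  unfolding axes_def by (intro closed_Collect_conj closed_Collect_disj closed_Collect_le closed_Collect_eq continuous_intros)

lemma closed_wedge: "closed (wedge b l)"
  unfolding wedge_def by (intro closed_Collect_conj closed_Collect_le continuous_intros)

lemma norm_le_sum_abs: "norm (x :: real ^ 2) \<le> \<bar>x $ 1\<bar> + \<bar>x $ 2\<bar>"
  using norm_le_l1_cart[of x] by (simp add: sum_2)

lemma compact_axes: "compact axes"
proof -
  have "norm w \<le> 2" if "w \<in> axes" for w
    using that norm_le_sum_abs[of w] unfolding axes_def by auto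
  then have "bounded axes" unfolding bounded_iff by blast
  then show ?thesis using closed_axes by (simp add: compact_eq_bounded_closed)
qed

lemma wedge_norm_le:
  assumes "w \<in> wedge b l" "1 \<le> b"
  shows "w $ 1 \<le> l" "w $ 2 \<le> l" "norm w \<le> 2 * l"
proof -
  have w: "0 \<le> w $ 1" "0 \<le> w $ 2" "w $ 2 + b * w $ 1 \<le> l" using assms unfolding wedge_def by auto
  have "w $ 1 \<le> b * w $ 1" using w assms(2) by (simp add: mult_le_cancel_right1)
  then show "w $ 1 \<le> l" "w $ 2 \<le> l" using w by linarith+
  then show "norm w \<le> 2 * l" using norm_le_sum_abs[of w] w by simp
qed

lemma compact_wedge: "1 \<le> b \<Longrightarrow> compact (wedge b l)"
  using wedge_norm_le(3) closed_wedge unfolding compact_eq_bounded_closed bounded_iff by blast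

lemma wedge_mono: "l \<le> m \<Longrightarrow> wedge b l \<subseteq> wedge b m"
  unfolding wedge_def by auto

lemma zero_in_axes: "0 \<in> axes" unfolding axes_def by simp

lemma zero_in_wedge: "0 \<le> l \<Longrightarrow> 0 \<in> wedge b l" unfolding wedge_def by simp

text \<open>Axes, nonempty wedges and their intersections and unions are all star-shaped at the origin; this supplies the
  connectedness that uniqueness of sections requires.\<close>

lemma scaled_connected:
  fixes S :: "'a::real_normed_vector set"
  assumes "0 \<in> S" "\<And>w t. w \<in> S \<Longrightarrow> 0 \<le> t \<Longrightarrow> t \<le> 1 \<Longrightarrow> t *\<^sub>R w \<in> S"
  shows "connected S"
proof (rule starlike_imp_connected)
  have "closed_segment 0 w \<subseteq> S" if "w \<in> S" for w
    using assms(2)[OF that] by (auto simp: in_segment)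
  then show "starlike S" unfolding starlike_def using assms(1) by blast
qed

lemma scale_axes: "w \<in> axes \<Longrightarrow> 0 \<le> t \<Longrightarrow> t \<le> 1 \<Longrightarrow> t *\<^sub>R w \<in> axes"
  unfolding axes_def by (auto simp: mult_le_one)

lemma scale_wedge:
  assumes w: "w \<in> wedge b l" and t: "0 \<le> t" "t \<le> 1" and l: "0 \<le> l"
  shows "t *\<^sub>R w \<in> wedge b l"
proof -
  have "t * (w $ 2 + b * w $ 1) \<le> t * l" using w t unfolding wedge_def by (simp add: mult_left_mono)
  also have "\<dots> \<le> l" using t l by (simp add: mult_left_le_one_le)
  finally show ?thesis using w t unfolding wedge_def by (simp add: algebra_simps)
qed

text \<open>The situation to be refuted: a section over the axes that does not extend to a wedge. The bound
  \<open>a < 1\<close> leaves room on the axes for lines of nearby slopes.\<close>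

locale blocked_wedge = real_spectral_gap +
  fixes H0 :: "real ^ 2 \<Rightarrow> real ^ 2" and a :: real
  assumes axes_section: "section_on G axes H0"
    and a: "0 < a" "a < 1"
    and blocked: "\<And>K. section_on G (wedge 1 a) K \<Longrightarrow> K 0 \<noteq> H0 0"
begin

definition fillable :: "real \<Rightarrow> real \<Rightarrow> bool" where
  "fillable b l \<longleftrightarrow> (\<exists>K. section_on G (axes \<union> wedge b l) K \<and> K 0 = H0 0)"

lemma fillings_agree:
  assumes "section_on G (axes \<union> wedge b l) K" "K 0 = H0 0" "0 \<le> l"
    and "section_on G (axes \<union> wedge c m) L" "L 0 = H0 0" "0 \<le> m"
    and w: "w \<in> axes \<union> wedge b l" "w \<in> axes \<union> wedge c m"
  shows "K w = L w"
proof (rule section_unique [OF locally_injective_G, where H = K and K = L and z = 0])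
  show "connected ((axes \<union> wedge b l) \<inter> (axes \<union> wedge c m))"
    by (rule scaled_connected) (use zero_in_axes scale_axes scale_wedge assms(3,6) in blast)+
  show "section_on G ((axes \<union> wedge b l) \<inter> (axes \<union> wedge c m)) K"
    "section_on G ((axes \<union> wedge b l) \<inter> (axes \<union> wedge c m)) L"
    by (rule section_on_subset [OF assms(1) Int_lower1], rule section_on_subset [OF assms(4) Int_lower2])
  show "0 \<in> (axes \<union> wedge b l) \<inter> (axes \<union> wedge c m)" using zero_in_axes by blast
  show "w \<in> (axes \<union> wedge b l) \<inter> (axes \<union> wedge c m)" using w by blast
  show "K 0 = L 0" using assms(2,5) by simp
qed

lemma fillable_mono: "fillable b l \<Longrightarrow> m \<le> l \<Longrightarrow> fillable b m"
  unfolding fillable_def using section_on_subset [OF _ Un_mono [OF order_refl wedge_mono]] by blast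

lemma fillable_zero: assumes "1 \<le> b" shows "fillable b 0"
proof -
  have "wedge b 0 \<subseteq> axes"
  proof
    fix w assume w: "w \<in> wedge b 0"
    then show "w \<in> axes" using wedge_norm_le[OF w assms] unfolding wedge_def axes_def by auto
  qed
  then show ?thesis unfolding fillable_def using axes_section by (metis sup.absorb1)
qed

text \<open>A section over a compact set extends to a neighbourhood, and that neighbourhood contains a slightly
  larger wedge: a point beyond the line is close to its multiple on the line.\<close>

lemma fillable_open:
  assumes b: "1 \<le> b" and l: "0 \<le> l" and "fillable b l"
  shows "\<exists>m>l. fillable b m"
proof -
  obtain K where K: "section_on G (axes \<union> wedge b l) K" "K 0 = H0 0"
    using \<open>fillable b l\<close> unfolding fillable_def by blast
  have comp: "compact (axes \<union> wedge b l)" using compact_axes compact_wedge[OF b] by blast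
  obtain U L where U: "open U" "axes \<union> wedge b l \<subseteq> U" "section_on G U L"
    "\<And>w. w \<in> axes \<union> wedge b l \<Longrightarrow> L w = K w"
    by (rule section_extends_to_open [OF locally_injective_G cont_G comp K(1)]) blast
  obtain e where e: "e > 0" "(\<Union>x\<in>axes \<union> wedge b l. ball x e) \<subseteq> U"
    using compact_subset_open_imp_ball_epsilon_subset [OF comp U(1,2)] by blast
  define m where "m = l + e / 4"
  have "wedge b m \<subseteq> U"
  proof
    fix w assume w: "w \<in> wedge b m"
    define s where "s = w $ 2 + b * w $ 1"
    show "w \<in> U"
    proof (cases "s \<le> l")
      case True
      then show ?thesis using w U(2) unfolding wedge_def s_def by blast
    next
      case False
      then have s: "0 < s" "l < s" "s \<le> m" using l w unfolding wedge_def s_def by auto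
      define v where "v = (l / s) *\<^sub>R w"
      have "l / s * (w $ 2 + b * w $ 1) = l" using s unfolding s_def by simp
      then have "v \<in> wedge b l"
        using w l s unfolding v_def wedge_def by (simp add: algebra_simps)
      moreover have "w \<in> wedge b s" using w unfolding wedge_def s_def by auto
      then have "norm w \<le> 2 * s" using wedge_norm_le(3) b by blast
      have "dist v w < e"
      proof -
        have "dist v w = norm ((1 - l / s) *\<^sub>R w)"
          unfolding v_def dist_norm by (metis norm_minus_commute scaleR_left_diff_distrib scaleR_one)
        also have "\<dots> = (1 - l / s) * norm w" using s by simp
        also have "\<dots> \<le> (1 - l / s) * (2 * s)"
          using \<open>norm w \<le> 2 * s\<close> s by (intro mult_left_mono) auto
        also have "\<dots> = 2 * (s - l)" using s by (simp add: field_simps)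
        also have "\<dots> < e" using s e(1) unfolding m_def by simp
        finally show ?thesis .
      qed
      ultimately show ?thesis using e(2) by (auto simp: subset_iff)
    qed
  qed
  then have "section_on G (axes \<union> wedge b m) L" using U section_on_subset by blast
  moreover have "L 0 = H0 0" using U(4) K(2) zero_in_axes by simp
  ultimately have "fillable b m" unfolding fillable_def by blast
  then show ?thesis using e(1) unfolding m_def by (intro exI[of _ "l + e / 4"]) simp
qed

lemma not_fillable: assumes "1 \<le> b" shows "\<not> fillable b (b * a)"
proof
  assume "fillable b (b * a)"
  then obtain K where K: "section_on G (axes \<union> wedge b (b * a)) K" "K 0 = H0 0"
    unfolding fillable_def by blast
  have "wedge 1 a \<subseteq> wedge b (b * a)"
  proof
    fix w assume w: "w \<in> wedge 1 a"
    then have "b * (w $ 2 + w $ 1) \<le> b * a" using assms unfolding wedge_def by simp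
    moreover have "w $ 2 \<le> b * w $ 2" using w assms unfolding wedge_def by (simp add: mult_le_cancel_right1)
    ultimately show "w \<in> wedge b (b * a)" using w unfolding wedge_def by (simp add: algebra_simps)
  qed
  then have "section_on G (wedge 1 a) K" using K(1) section_on_subset by blast
  then show False using blocked K(2) by blast
qed

text \<open>The position at which the line of slope \<open>-b\<close> is stopped.\<close>

definition crit :: "real \<Rightarrow> real" where
  "crit b = Sup {l. 0 \<le> l \<and> fillable b l}"

lemma crit_properties:
  assumes b: "1 \<le> b"
  shows fillable_below_crit: "l < crit b \<Longrightarrow> fillable b l"
    and not_fillable_crit: "\<not> fillable b (crit b)"
    and crit_pos: "0 < crit b" and crit_le: "crit b \<le> b * a"
proof -
  let ?S = "{l. 0 \<le> l \<and> fillable b l}"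
  have ne: "0 \<in> ?S" using fillable_zero[OF b] by simp
  have ub: "l \<le> b * a" if "l \<in> ?S" for l
    using that not_fillable[OF b] fillable_mono[of b l "b * a"] by force
  have bdd: "bdd_above ?S" using ub by (meson bdd_aboveI)
  show below: "fillable b l" if l: "l < crit b" for l
  proof -
    obtain m where "m \<in> ?S" "l < m"
      using l less_cSup_iff[of ?S l] ne bdd unfolding crit_def by blast
    then show ?thesis using fillable_mono[of b m l] by simp
  qed
  have upper: "l \<le> crit b" if "l \<in> ?S" for l
    unfolding crit_def using that bdd by (rule cSup_upper)
  have ge0: "0 \<le> crit b" using upper ne by blast
  show ng: "\<not> fillable b (crit b)"
  proof
    assume "fillable b (crit b)"
    then obtain m where "m > crit b" "fillable b m" using fillable_open[OF b ge0] by blast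
    then show False using upper[of m] ge0 by simp
  qed
  show "0 < crit b" using ge0 ng fillable_zero[OF b] by (cases "crit b = 0") auto
  show "crit b \<le> b * a" unfolding crit_def using ne ub by (intro cSup_least) auto
qed

text \<open>All sections over the axes and a wedge, for all slopes at once, agree where they are defined together
  (\<open>fillings_agree\<close>), so they are restrictions of a single function. Where none of them is defined, the
  value is arbitrary.\<close>

definition H :: "real ^ 2 \<Rightarrow> real ^ 2" where
  "H w = (SOME x. \<exists>b l K. section_on G (axes \<union> wedge b l) K \<and> K 0 = H0 0 \<and> 0 \<le> l \<and>
            w \<in> axes \<union> wedge b l \<and> x = K w)"

lemma H_eq:
  assumes K: "section_on G (axes \<union> wedge b l) K" "K 0 = H0 0" "0 \<le> l" "w \<in> axes \<union> wedge b l"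
  shows "H w = K w"
proof -
  have "\<exists>x b l K. section_on G (axes \<union> wedge b l) K \<and> K 0 = H0 0 \<and> 0 \<le> l \<and>
            w \<in> axes \<union> wedge b l \<and> x = K w" using K by blast
  then have "\<exists>b l K. section_on G (axes \<union> wedge b l) K \<and> K 0 = H0 0 \<and> 0 \<le> l \<and>
            w \<in> axes \<union> wedge b l \<and> H w = K w"
    unfolding H_def by (rule someI_ex)
  then obtain c m L where "section_on G (axes \<union> wedge c m) L" "L 0 = H0 0" "0 \<le> m"
     "w \<in> axes \<union> wedge c m" "H w = L w" by blast
  then show ?thesis using fillings_agree[OF _ _ _ K(1-3), of c m L w] K(4) by simp
qed

lemma section_H: assumes "fillable b l" "0 \<le> l" shows "section_on G (axes \<union> wedge b l) H"
proof -
  obtain K where K: "section_on G (axes \<union> wedge b l) K" "K 0 = H0 0"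
    using \<open>fillable b l\<close> unfolding fillable_def by blast
  then show ?thesis using section_on_cong[of "axes \<union> wedge b l" H K G] H_eq[OF K assms(2)] by blast
qed

lemma H_axes: "w \<in> axes \<Longrightarrow> H w = H0 w"
proof -
  obtain K where K: "section_on G (axes \<union> wedge 1 0) K" "K 0 = H0 0"
    using fillable_zero[of 1] unfolding fillable_def by auto
  assume w: "w \<in> axes"
  have "K w = H0 w"
  proof (rule section_unique [OF locally_injective_G, where H = K and K = H0 and z = 0 and S = axes])
    show "connected axes" by (rule scaled_connected) (use zero_in_axes scale_axes in blast)+
    show "section_on G axes K" using K(1) section_on_subset by blast
  qed (use axes_section zero_in_axes K(2) w in auto)
  then show ?thesis using H_eq[OF K] w by simp
qed

definition swept :: "real \<Rightarrow> (real ^ 2) set" where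
  "swept b = {w. 0 \<le> w $ 1 \<and> 0 \<le> w $ 2 \<and> w $ 2 + b * w $ 1 < crit b}"

lemma wedge_subset_swept: "l < crit b \<Longrightarrow> wedge b l \<subseteq> swept b"
  unfolding wedge_def swept_def by auto

lemma section_wedge: "1 \<le> b \<Longrightarrow> 0 \<le> l \<Longrightarrow> l < crit b \<Longrightarrow> section_on G (wedge b l) H"
  using section_H fillable_below_crit section_on_subset by blast

lemma section_swept: assumes b: "1 \<le> b" shows "section_on G (swept b) H"
  unfolding section_on_def
proof
  have mem: "w \<in> wedge b (max 0 (w $ 2 + b * w $ 1)) \<and> max 0 (w $ 2 + b * w $ 1) < crit b" if "w \<in> swept b" for w
    using that crit_pos[OF b] unfolding swept_def wedge_def by auto
  show "\<forall>w\<in>swept b. G (H w) = w"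
    using mem section_wedge[OF b] unfolding section_on_def by (metis max.cobounded1)
  show "continuous_on (swept b) H"
    unfolding continuous_on_eq_continuous_within
  proof
    fix w assume w: "w \<in> swept b"
    define l where "l = (max 0 (w $ 2 + b * w $ 1) + crit b) / 2"
    have l: "w $ 2 + b * w $ 1 < l" "0 \<le> l" "l < crit b" using mem[OF w] unfolding l_def by auto
    have op: "open {v::real^2. v $ 2 + b * v $ 1 < l}" by (intro open_Collect_less continuous_intros)
    have sub: "swept b \<inter> {v. v $ 2 + b * v $ 1 < l} \<subseteq> wedge b l" unfolding swept_def wedge_def by auto
    have "continuous_on (swept b \<inter> {v. v $ 2 + b * v $ 1 < l}) H"
      using section_wedge[OF b l(2,3)] sub continuous_on_subset unfolding section_on_def by blast
    then have "continuous (at w within (swept b \<inter> {v. v $ 2 + b * v $ 1 < l})) H"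
      using w l(1) by (simp add: continuous_on_eq_continuous_within)
    moreover have "at w within (swept b \<inter> {v. v $ 2 + b * v $ 1 < l}) = at w within swept b"
      by (rule at_within_nhd [OF _ op]) (use l(1) in auto)
    ultimately show "continuous (at w within swept b) H" by (simp add: continuous_within)
  qed
qed

definition swept_interior :: "real \<Rightarrow> (real ^ 2) set" where
  "swept_interior b = {w. 0 < w $ 1 \<and> 0 < w $ 2 \<and> w $ 2 + b * w $ 1 < crit b}"

lemma open_swept_interior: "open (swept_interior b)"
  unfolding swept_interior_def by (intro open_Collect_conj open_Collect_less continuous_intros)

lemma swept_interior_subset: "swept_interior b \<subseteq> swept b"
  unfolding swept_interior_def swept_def by auto

lemma H_has_derivative:
  "1 \<le> b \<Longrightarrow> w \<in> swept_interior b \<Longrightarrow> (H has_derivative (\<lambda>h. matrix_inv (J (H w)) *v h)) (at w)"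
  using section_has_derivative [OF open_swept_interior section_on_subset [OF section_swept swept_interior_subset]] .

lemma linear_functional_derivative:
  assumes b: "1 \<le> b" and w: "w \<in> swept_interior b"
  shows "((\<lambda>v. p * H v $ 1 + q * H v $ 2 + r * (v $ 2 + b * v $ 1)) has_derivative
     (\<lambda>h. p * (matrix_inv (J (H w)) *v h) $ 1 + q * (matrix_inv (J (H w)) *v h) $ 2
        + r * (h $ 2 + b * h $ 1))) (at w)"
proof -
  have nth: "((\<lambda>v. H v $ i) has_derivative (\<lambda>h. (matrix_inv (J (H w)) *v h) $ i)) (at w)" for i
    by (rule bounded_linear.has_derivative [OF bounded_linear_vec_nth H_has_derivative [OF b w]])
  have id: "((\<lambda>v. v $ i) has_derivative (\<lambda>h. h $ i)) (at w)" for i :: 2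
    by (rule bounded_linear_imp_has_derivative [OF bounded_linear_vec_nth])
  show ?thesis
    by (intro has_derivative_add has_derivative_mult_right nth id)
qed

section \<open>The image of the swept region\<close>

text \<open>First-order conditions at a maximum, for a linear combination of the two components of \<open>H\<close> and of the
  position of the sweeping line. Away from the axes one may move along the line in both directions,
  which gives the equation, and downwards, which gives the inequality.\<close>

lemma wedge_maximum:
  assumes b: "1 \<le> b" "b * a < 1" and l: "0 \<le> l" "l < crit b"
    and f_def: "f = (\<lambda>v. p * H v $ 1 + q * H v $ 2 + r * (v $ 2 + b * v $ 1))"
  obtains w where "w \<in> wedge b l" "\<And>v. v \<in> wedge b l \<Longrightarrow> f v \<le> f w"
    "w \<notin> axes \<Longrightarrow> w \<in> swept_interior b \<and> 
      p * matrix_inv (J (H w)) $ 1 $ 1 + q * matrix_inv (J (H w)) $ 2 $ 1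
        = b * (p * matrix_inv (J (H w)) $ 1 $ 2 + q * matrix_inv (J (H w)) $ 2 $ 2) \<and>
      0 \<le> p * matrix_inv (J (H w)) $ 1 $ 2 + q * matrix_inv (J (H w)) $ 2 $ 2 + r"
proof -
  have cont: "continuous_on (wedge b l) f"
    using section_wedge[OF b(1) l] unfolding f_def section_on_def by (intro continuous_intros) auto
  obtain w where w: "w \<in> wedge b l" "\<And>v. v \<in> wedge b l \<Longrightarrow> f v \<le> f w"
    using continuous_attains_sup [OF compact_wedge[OF b(1)] _ cont] zero_in_wedge[OF l(1)] by blast
  have "w \<in> swept_interior b \<and> 
      p * matrix_inv (J (H w)) $ 1 $ 1 + q * matrix_inv (J (H w)) $ 2 $ 1
        = b * (p * matrix_inv (J (H w)) $ 1 $ 2 + q * matrix_inv (J (H w)) $ 2 $ 2) \<and>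
      0 \<le> p * matrix_inv (J (H w)) $ 1 $ 2 + q * matrix_inv (J (H w)) $ 2 $ 2 + r" if nax: "w \<notin> axes"
  proof -
    have "l \<le> 1" using l(2) crit_le[OF b(1)] b(2) by linarith
    then have "w $ 1 \<le> 1" "w $ 2 \<le> 1" using wedge_norm_le[OF w(1) b(1)] by linarith+
    then have pos: "0 < w $ 1" "0 < w $ 2"
      using w(1) nax unfolding axes_def wedge_def by auto
    have inner: "w \<in> swept_interior b" using pos w(1) l(2) unfolding swept_interior_def wedge_def by simp
    define N where "N = matrix_inv (J (H w))"
    define f' where "f' = (\<lambda>h. p * (N *v h) $ 1 + q * (N *v h) $ 2 + r * (h $ 2 + b * h $ 1))"
    have der: "(f has_derivative f') (at w)"
      unfolding f_def f'_def N_def by (rule linear_functional_derivative [OF b(1) inner])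
    have f': "f' h = (p * N $ 1 $ 1 + q * N $ 2 $ 1) * h $ 1 + (p * N $ 1 $ 2 + q * N $ 2 $ 2) * h $ 2
        + r * (h $ 2 + b * h $ 1)" for h
      unfolding f'_def by (simp add: matrix_vector_mult_def sum_2 algebra_simps)
    have feas: "f' d \<le> 0" if d: "d $ 2 + b * d $ 1 \<le> 0" for d :: "real ^ 2"
    proof -
      define e where "e = min (w $ 1 / (1 + \<bar>d $ 1\<bar>)) (w $ 2 / (1 + \<bar>d $ 2\<bar>))"
      have e: "0 < e" unfolding e_def using pos by (simp add: add_pos_nonneg)
      have stay: "0 \<le> w $ i + t * d $ i" if t: "0 < t" "t < e" and i: "t < w $ i / (1 + \<bar>d $ i\<bar>)" for t i
      proof -
        have "t * (1 + \<bar>d $ i\<bar>) < w $ i"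
          using i by (simp add: pos_less_divide_eq add_pos_nonneg)
        moreover have "- (t * d $ i) \<le> t * \<bar>d $ i\<bar>" using mult_left_mono[of "- d $ i" "\<bar>d $ i\<bar>" t] t by simp
        ultimately show ?thesis using t by (simp add: algebra_simps)
      qed
      show ?thesis
      proof (rule feasible_direction_derivative_le [OF der e])
        fix t assume t: "0 < t" "t < e"
        have "t * (d $ 2 + b * d $ 1) \<le> 0" using t d by (simp add: mult_le_0_iff)
        then have "w + t *\<^sub>R d \<in> wedge b l"
          using stay[OF t, of 1] stay[OF t, of 2] t w(1) unfolding e_def wedge_def
          by (simp add: algebra_simps)
        then show "f (w + t *\<^sub>R d) \<le> f w" by (rule w(2))
      qed
    qed
    have "f' (vector [1, -b]) \<le> 0" "f' (vector [-1, b]) \<le> 0" "f' (vector [0, -1]) \<le> 0"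
      by (intro feas; simp)+
    then show ?thesis using inner unfolding f' N_def by (simp add: algebra_simps)
  qed
  then show thesis using that w by blast
qed

text \<open>A maximum principle. Subtract \<open>L\<close> times the position of the line from \<open>y + b x\<close> or its
  negative. A maximum off the axes would make \<open>(b, 1)\<close> a left eigenvector of the derivative of \<open>H\<close> whose eigenvalue has modulus at
  least \<open>L = 2/\<delta>\<close>, and then \<open>G\<close> would have a real eigenvalue of modulus less than \<open>\<delta>\<close>. So the
  maximum is attained on the axes, where \<open>H\<close> is bounded.\<close>

lemma image_in_strip:
  assumes b: "1 \<le> b" "b * a < 1"
  obtains C where "\<And>w. w \<in> swept b \<Longrightarrow> \<bar>H w $ 2 + b * H w $ 1\<bar> \<le> C"
proof -
  have "bounded (H0 ` axes)"
    using axes_section compact_axes unfolding section_on_def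
    by (intro compact_imp_bounded compact_continuous_image) auto
  then obtain B where B: "\<And>w. w \<in> axes \<Longrightarrow> norm (H0 w) \<le> B" unfolding bounded_iff by (metis imageI)
  define L where "L = 2 / \<delta>"
  have L: "0 < L" unfolding L_def using gap_pos by simp
  have main: "s * (H v $ 2 + b * H v $ 1) \<le> (1 + b) * B + L * crit b"
    if s: "\<bar>s\<bar> = 1" and v: "v \<in> swept b" for s v
  proof -
    define l where "l = v $ 2 + b * v $ 1"
    have l: "0 \<le> l" "l < crit b" "v \<in> wedge b l"
      using v b unfolding swept_def wedge_def l_def by auto
    define f where "f = (\<lambda>v. (s * b) * H v $ 1 + s * H v $ 2 + (-L) * (v $ 2 + b * v $ 1))"
    obtain w where w: "w \<in> wedge b l" "\<And>v. v \<in> wedge b l \<Longrightarrow> f v \<le> f w"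
      "w \<notin> axes \<Longrightarrow> w \<in> swept_interior b \<and> 
      (s * b) * matrix_inv (J (H w)) $ 1 $ 1 + s * matrix_inv (J (H w)) $ 2 $ 1
        = b * ((s * b) * matrix_inv (J (H w)) $ 1 $ 2 + s * matrix_inv (J (H w)) $ 2 $ 2) \<and>
      0 \<le> (s * b) * matrix_inv (J (H w)) $ 1 $ 2 + s * matrix_inv (J (H w)) $ 2 $ 2 + (-L)"
      by (rule wedge_maximum [OF b l(1,2) f_def]) blast
    have "w \<in> axes"
    proof (rule ccontr)
      assume nax: "w \<notin> axes"
      define N where "N = matrix_inv (J (H w))"
      define c where "c = b * N $ 1 $ 2 + N $ 2 $ 2"
      have s2: "s = 1 \<or> s = -1" using s by linarith
      have cL: "L \<le> s * c" and row: "b * N $ 1 $ 1 + N $ 2 $ 1 = c * b"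
        using w(3)[OF nax] s2 unfolding c_def N_def by (auto simp: algebra_simps)
      have cL': "L \<le> \<bar>c\<bar>" using cL s2 by auto
      then have "c \<noteq> 0" using L by auto
      have "det (J (H w) - mat (1 / c)) = 0"
        by (rule left_eigenvector_of_inverse [OF _ \<open>c \<noteq> 0\<close> row])
           (simp_all add: N_def c_def inverse_jacobian)
      moreover have "\<bar>1 / c\<bar> < \<delta>"
      proof -
        have "\<bar>1 / c\<bar> = 1 / \<bar>c\<bar>" by simp
        also have "\<dots> \<le> 1 / L" using cL' L by (intro divide_left_mono) auto
        also have "\<dots> < \<delta>" unfolding L_def using gap_pos by simp
        finally show ?thesis .
      qed
      ultimately show False using gap by blast
    qed
    have "H v $ 2 * s + b * (H v $ 1 * s) - L * l \<le> f w"
      using w(2)[OF l(3)] unfolding f_def l_def by (simp add: algebra_simps)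
    also have "f w \<le> s * (b * H w $ 1 + H w $ 2)"
      unfolding f_def using w(1) L b unfolding wedge_def by (simp add: algebra_simps)
    also have "\<dots> \<le> \<bar>b * H w $ 1 + H w $ 2\<bar>"
      using s abs_ge_self[of "s * (b * H w $ 1 + H w $ 2)"] by (simp add: abs_mult)
    also have "\<dots> \<le> b * \<bar>H w $ 1\<bar> + \<bar>H w $ 2\<bar>"
      using b abs_triangle_ineq[of "b * H w $ 1" "H w $ 2"] by (simp add: abs_mult)
    also have "\<dots> \<le> b * B + B"
      using B[OF \<open>w \<in> axes\<close>] H_axes[OF \<open>w \<in> axes\<close>] component_le_norm_cart[of "H w" 1]
        component_le_norm_cart[of "H w" 2] b
      by (intro add_mono mult_left_mono) auto
    finally have "s * (H v $ 2 + b * H v $ 1) \<le> (1 + b) * B + L * l"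
      by (simp add: algebra_simps)
    moreover have "L * l \<le> L * crit b" using l L by (intro mult_left_mono) auto
    ultimately show ?thesis by linarith
  qed
  show thesis
  proof
    fix w assume "w \<in> swept b"
    then show "\<bar>H w $ 2 + b * H w $ 1\<bar> \<le> (1 + b) * B + L * crit b"
      using main[of 1 w] main[of "-1" w] by (simp add: abs_le_iff)
  qed
qed

text \<open>On a bounded image the derivative of \<open>H\<close> is bounded, so \<open>H\<close> is Lipschitz continuous and extends to
  the closure of the swept region, which contains the wedge at the stopping position. The line would
  not be stopped there.\<close>

lemma unbounded_on_swept:
  assumes b: "1 \<le> b"
  shows "\<exists>w\<in>swept b. B < norm (H w)"
proof (rule ccontr)
  assume "\<not> ?thesis"
  then have bd: "norm (H w) \<le> B" if "w \<in> swept b" for w using that by force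
  obtain L where L: "\<And>x. norm x \<le> B \<Longrightarrow> onorm (\<lambda>h. matrix_inv (J x) *v h) \<le> L"
    by (rule inverse_jacobian_bounded [where B = B]) blast
  have conv: "convex (swept_interior b)"
  proof -
    have "swept_interior b = {w. 0 < w $ 1} \<inter> {w. 0 < w $ 2} \<inter> {w. vector [b, 1] \<bullet> w < crit b}"
      unfolding swept_interior_def by (auto simp: inner_vec_def sum_2 algebra_simps)
    moreover have "{w :: real ^ 2. 0 < w $ i} = {w. axis i 1 \<bullet> w > 0}" for i
      by (simp add: inner_axis')
    ultimately show ?thesis
      by (simp add: convex_Int convex_halfspace_gt convex_halfspace_lt)
  qed
  have lip: "norm (H x - H y) \<le> L * norm (x - y)" if "x \<in> swept_interior b" "y \<in> swept_interior b" for x y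
  proof (rule differentiable_bound [OF conv _ _ that(1,2)])
    fix z assume z: "z \<in> swept_interior b"
    show "(H has_derivative (\<lambda>h. matrix_inv (J (H z)) *v h)) (at z within swept_interior b)"
      using H_has_derivative [OF b z] by (rule has_derivative_at_withinI)
    show "onorm (\<lambda>h. matrix_inv (J (H z)) *v h) \<le> L"
      using L bd z swept_interior_subset by blast
  qed
  have "uniformly_continuous_on (swept_interior b) H"
    unfolding uniformly_continuous_on_def
  proof (intro allI impI)
    fix e :: real assume e: "e > 0"
    have "dist (H y) (H x) < e" if "x \<in> swept_interior b" "y \<in> swept_interior b" "dist y x < e / (1 + \<bar>L\<bar>)" for x y
    proof -
      have "dist (H y) (H x) \<le> L * dist y x" using lip[of y x] that by (simp add: dist_norm)
      also have "\<dots> \<le> (1 + \<bar>L\<bar>) * dist y x" by (intro mult_right_mono) auto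
      also have "\<dots> < e" using that(3) by (simp add: pos_less_divide_eq add_pos_nonneg mult.commute)
      finally show ?thesis .
    qed
    moreover have "0 < e / (1 + \<bar>L\<bar>)" using e by (simp add: add_pos_nonneg)
    ultimately show "\<exists>d>0. \<forall>x\<in>swept_interior b. \<forall>x'\<in>swept_interior b. dist x' x < d \<longrightarrow> dist (H x') (H x) < e" by blast
  qed
  then obtain g where g: "uniformly_continuous_on (closure (swept_interior b)) g"
    "\<And>x. x \<in> swept_interior b \<Longrightarrow> H x = g x"
    "\<And>Y h x. swept_interior b \<subseteq> Y \<Longrightarrow> Y \<subseteq> closure (swept_interior b) \<Longrightarrow> continuous_on Y h \<Longrightarrow>
       (\<And>x. x \<in> swept_interior b \<Longrightarrow> H x = h x) \<Longrightarrow> x \<in> Y \<Longrightarrow> h x = g x"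
    by (rule uniformly_continuous_on_extension_on_closure) blast
  have k: "0 < crit b" by (rule crit_pos [OF b])
  have clos: "wedge b (crit b) \<subseteq> closure (swept_interior b)"
  proof
    fix w assume w: "w \<in> wedge b (crit b)"
    define c :: "real ^ 2" where "c = vector [crit b / (3 * b), crit b / 3]"
    have "(1 - t) *\<^sub>R w + t *\<^sub>R c \<in> swept_interior b" if t: "0 < t" "t \<le> 1" for t
    proof -
      have "(1 - t) * (w $ 2 + b * w $ 1) \<le> (1 - t) * crit b"
        using w t unfolding wedge_def by (intro mult_left_mono) auto
      moreover have "t * (c $ 2 + b * c $ 1) < t * crit b"
        unfolding c_def using t k b by simp
      moreover have "0 < t * c $ 1" "0 < t * c $ 2" unfolding c_def using t k b by simp_all
      moreover have "0 \<le> (1 - t) * w $ 1" "0 \<le> (1 - t) * w $ 2" using w t unfolding wedge_def by simp_all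
      ultimately show ?thesis unfolding swept_interior_def by (simp add: algebra_simps)
    qed
    note mem = this
    define z where "z n = (1 - inverse (real (Suc n))) *\<^sub>R w + inverse (real (Suc n)) *\<^sub>R c" for n
    have "z \<longlonglongrightarrow> (1 - 0) *\<^sub>R w + 0 *\<^sub>R c"
      unfolding z_def by (intro tendsto_intros LIMSEQ_inverse_real_of_nat)
    then have "z \<longlonglongrightarrow> w" by simp
    moreover have "\<forall>n. z n \<in> swept_interior b"
      unfolding z_def by (intro allI mem) (simp_all add: inverse_le_1_iff)
    ultimately show "w \<in> closure (swept_interior b)" unfolding closure_sequential by blast
  qed
  have cg: "continuous_on (closure (swept_interior b)) g" using g(1) by (rule uniformly_continuous_imp_continuous)
  have Gg: "G (g w) - w = 0" if w: "w \<in> closure (swept_interior b)" for w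
  proof (rule continuous_constant_on_closure [of "swept_interior b" "\<lambda>w. G (g w) - w"])
    show "continuous_on (closure (swept_interior b)) (\<lambda>w. G (g w) - w)"
      by (intro continuous_intros continuous_on_compose2 [OF cont_G cg]) auto
    fix v assume "v \<in> swept_interior b"
    then show "G (g v) - v = 0"
      using g(2)[of v] section_swept[OF b] swept_interior_subset unfolding section_on_def by force
  qed (rule w)
  then have sec_g: "section_on G (wedge b (crit b)) g"
    unfolding section_on_def using clos continuous_on_subset[OF cg clos] by auto
  have "H 0 = g 0"
  proof (rule g(3) [of "swept b" H 0])
    show "swept b \<subseteq> closure (swept_interior b)" using clos unfolding swept_def wedge_def by force
    show "continuous_on (swept b) H" using section_swept[OF b] unfolding section_on_def by blast
    show "0 \<in> swept b" using k unfolding swept_def by simp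
  qed (use swept_interior_subset in auto)
  then have g0: "H0 0 = g 0" using H_axes[OF zero_in_axes] by simp
  have conn: "connected (axes \<inter> wedge b (crit b))"
    by (rule scaled_connected)
       (use zero_in_axes zero_in_wedge scale_axes scale_wedge k in \<open>auto simp: less_imp_le\<close>)
  have zero: "0 \<in> axes \<inter> wedge b (crit b)" using zero_in_axes zero_in_wedge k by simp
  obtain K where "section_on G (axes \<union> wedge b (crit b)) K" "\<And>w. w \<in> axes \<Longrightarrow> K w = H0 w"
    by (rule section_glue [OF locally_injective_G closed_axes axes_section closed_wedge sec_g conn zero g0]) blast
  then have "fillable b (crit b)" unfolding fillable_def using zero_in_axes by blast
  then show False using not_fillable_crit[OF b] by blast
qed

section \<open>Three escapes towards the same end\<close>

lemma strips_meet_in_bounded_set: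
  assumes w: "\<bar>H w $ 2 + b * H w $ 1\<bar> \<le> C" "\<bar>H w $ 2 + c * H w $ 1\<bar> \<le> C"
    and g: "0 < g" "g \<le> \<bar>b - c\<bar>"
  shows "\<bar>H w $ 1\<bar> \<le> 2 * C / g"
proof -
  have "(b - c) * H w $ 1 = (H w $ 2 + b * H w $ 1) - (H w $ 2 + c * H w $ 1)"
    by (simp add: algebra_simps)
  then have "\<bar>b - c\<bar> * \<bar>H w $ 1\<bar> \<le> 2 * C" using w unfolding abs_mult [symmetric] by linarith
  moreover have "g * \<bar>H w $ 1\<bar> \<le> \<bar>b - c\<bar> * \<bar>H w $ 1\<bar>" using g by (intro mult_right_mono) auto
  ultimately show ?thesis using g by (simp add: pos_le_divide_eq mult.commute)
qed

definition escapes :: "real \<Rightarrow> real \<Rightarrow> bool" where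
  "escapes s b \<longleftrightarrow> (\<forall>N. \<exists>w\<in>swept b. N \<le> s * H w $ 1)"

lemma escapes_some_direction:
  assumes b: "1 \<le> b" "b * a < 1"
  shows "escapes 1 b \<or> escapes (-1) b"
proof (rule ccontr)
  assume "\<not> ?thesis"
  then obtain M N where MN: "\<And>w. w \<in> swept b \<Longrightarrow> H w $ 1 < M" "\<And>w. w \<in> swept b \<Longrightarrow> - H w $ 1 < N"
    unfolding escapes_def by (auto simp: not_le)
  obtain C where C: "\<And>w. w \<in> swept b \<Longrightarrow> \<bar>H w $ 2 + b * H w $ 1\<bar> \<le> C" using image_in_strip [OF b] by blast
  have "norm (H w) \<le> C + (1 + b) * (\<bar>M\<bar> + \<bar>N\<bar>)" if w: "w \<in> swept b" for w
  proof -
    have x: "\<bar>H w $ 1\<bar> \<le> \<bar>M\<bar> + \<bar>N\<bar>" using MN[OF w] by linarith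
    have "\<bar>H w $ 2\<bar> \<le> \<bar>H w $ 2 + b * H w $ 1\<bar> + \<bar>b * H w $ 1\<bar>" by linarith
    also have "\<dots> \<le> C + b * \<bar>H w $ 1\<bar>" using C[OF w] b by (simp add: abs_mult)
    finally have "norm (H w) \<le> C + (1 + b) * \<bar>H w $ 1\<bar>"
      using norm_le_sum_abs[of "H w"] by (simp add: algebra_simps)
    also have "\<dots> \<le> C + (1 + b) * (\<bar>M\<bar> + \<bar>N\<bar>)" using x b by (intro add_left_mono mult_left_mono) auto
    finally show ?thesis .
  qed
  then show False using unbounded_on_swept[OF b(1)] by (meson not_less)
qed

text \<open>The slopes must stay below \<open>1/a\<close>, so that the sweeping lines meet the axes within unit distance of
  the origin, where the section over the axes is given.\<close>

lemma three_slopes_escape_same_way: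
  obtains s b1 b2 b3 where "s = 1 \<or> s = -1" "b2 < b1" "b3 < b2" "1 \<le> b3" "b1 * a < 1"
    "escapes s b1" "escapes s b2" "escapes s b3"
proof -
  note result = that
  define c where "c n = 1 + (1 / a - 1) / (real n + 2)" for n :: nat
  have pos: "0 < 1 / a - 1" using a by simp
  have c1: "1 \<le> c n" for n unfolding c_def using pos by simp
  have ca: "c n * a < 1" for n
  proof -
    have "(1 / a - 1) / (real n + 2) < (1 / a - 1) / 1"
      using pos by (intro divide_strict_left_mono) auto
    then have "c n < 1 / a" unfolding c_def by simp
    then show ?thesis using a by (simp add: field_simps)
  qed
  have anti: "c n < c m" if "m < n" for m n
    unfolding c_def using that pos by (simp add: divide_strict_left_mono)
  have three: thesis if inf: "infinite {n. escapes s (c n)}" and s: "s = 1 \<or> s = -1" for s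
  proof -
    obtain n1 where n1: "escapes s (c n1)" using not_finite_existsD[OF inf] by blast
    obtain n2 where n2: "n1 < n2" "escapes s (c n2)"
      using inf unfolding infinite_nat_iff_unbounded by blast
    obtain n3 where n3: "n2 < n3" "escapes s (c n3)"
      using inf unfolding infinite_nat_iff_unbounded by blast
    show thesis using result[OF s, of "c n2" "c n1" "c n3"] n1 n2 n3 anti c1 ca by blast
  qed
  have "{n. escapes 1 (c n)} \<union> {n. escapes (-1) (c n)} = UNIV"
    using escapes_some_direction[OF c1 ca] by auto
  then have "infinite {n. escapes 1 (c n)} \<or> infinite {n. escapes (-1) (c n)}"
    by (metis finite_UnI infinite_UNIV_nat)
  then show thesis using three by blast
qed

text \<open>Measure the distance along the strips by \<open>X = s x\<close>. Choose \<open>w2\<close> as the outermost point, at distance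
  \<open>N\<close>, over a large wedge of the second slope, and then \<open>w1\<close> and \<open>w3\<close> at least as far out for the other
  two slopes. A point in two of the swept regions lies in two of the strips, hence is not far out. So
  none of the three points lies in a swept region of a neighbouring slope. This fixes the order of the
  points and of the intersections of the lines of the three slopes through them, and the maximum of
  the three lines, taken from \<open>w1\<close> to \<open>w3\<close>, is a path inside the swept regions. Its image under \<open>H\<close>,
  trimmed to its last and first visits to distance \<open>N\<close> in the outer strips, contradicts
  \<open>no_backward_contact\<close>.\<close>

lemma no_blocked_wedge: False
proof -
  obtain s b1 b2 b3 where s: "s = 1 \<or> s = -1" and b: "b2 < b1" "b3 < b2" "1 \<le> b3" "b1 * a < 1"
    and esc: "escapes s b1" "escapes s b2" "escapes s b3"
    by (rule three_slopes_escape_same_way)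
  have b1: "1 \<le> b1" and b2: "1 \<le> b2" using b by linarith+
  have "b2 * a \<le> b1 * a" "b3 * a \<le> b1 * a" using b a by (simp_all add: mult_right_mono)
  then have ba: "b2 * a < 1" "b3 * a < 1" using b by linarith+
  have ss: "s * s = 1" and s1: "\<bar>s\<bar> = 1" and s0: "s \<noteq> 0" using s by auto
  obtain C1 where C1: "\<And>w. w \<in> swept b1 \<Longrightarrow> \<bar>H w $ 2 + b1 * H w $ 1\<bar> \<le> C1"
    using image_in_strip [OF b1 b(4)] by blast
  obtain C2 where C2: "\<And>w. w \<in> swept b2 \<Longrightarrow> \<bar>H w $ 2 + b2 * H w $ 1\<bar> \<le> C2"
    using image_in_strip [OF b2 ba(1)] by blast
  obtain C3 where C3: "\<And>w. w \<in> swept b3 \<Longrightarrow> \<bar>H w $ 2 + b3 * H w $ 1\<bar> \<le> C3"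
    using image_in_strip [OF b(3) ba(2)] by blast
  define C where "C = \<bar>C1\<bar> + \<bar>C2\<bar> + \<bar>C3\<bar>"
  have C: "\<bar>H w $ 2 + b1 * H w $ 1\<bar> \<le> C" if "w \<in> swept b1" for w
    using C1[OF that] unfolding C_def by linarith
  have C': "\<bar>H w $ 2 + b2 * H w $ 1\<bar> \<le> C" if "w \<in> swept b2" for w
    using C2[OF that] unfolding C_def by linarith
  have C'': "\<bar>H w $ 2 + b3 * H w $ 1\<bar> \<le> C" if "w \<in> swept b3" for w
    using C3[OF that] unfolding C_def by linarith
  define g where "g = min (b1 - b2) (b2 - b3)"
  have g: "0 < g" "g \<le> b1 - b2" "g \<le> b2 - b3" unfolding g_def using b by auto
  define T where "T = 2 * C / g"
  have apart12: "\<bar>H w $ 1\<bar> \<le> T" if "w \<in> swept b1" "w \<in> swept b2" for w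
    unfolding T_def by (rule strips_meet_in_bounded_set [OF C C' g(1)]) (use that g in auto)
  have apart23: "\<bar>H w $ 1\<bar> \<le> T" if "w \<in> swept b2" "w \<in> swept b3" for w
    unfolding T_def by (rule strips_meet_in_bounded_set [OF C' C'' g(1)]) (use that g in auto)
  have "bounded (H0 ` axes)"
    using axes_section compact_axes unfolding section_on_def
    by (intro compact_imp_bounded compact_continuous_image) auto
  then obtain B where B: "\<And>w. w \<in> axes \<Longrightarrow> norm (H0 w) \<le> B" unfolding bounded_iff by (metis imageI)
  obtain w' where w': "w' \<in> swept b2" "max T B + 1 \<le> s * H w' $ 1"
    using esc(2) unfolding escapes_def by blast
  define l where "l = w' $ 2 + b2 * w' $ 1"
  have l: "0 \<le> l" "l < crit b2" "w' \<in> wedge b2 l"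
    using w'(1) b2 unfolding swept_def wedge_def l_def by auto
  define f where "f = (\<lambda>v. s * H v $ 1 + 0 * H v $ 2 + 0 * (v $ 2 + b2 * v $ 1))"
  obtain w2 where w2: "w2 \<in> wedge b2 l" "\<And>v. v \<in> wedge b2 l \<Longrightarrow> f v \<le> f w2"
    "w2 \<notin> axes \<Longrightarrow> w2 \<in> swept_interior b2 \<and>
      s * matrix_inv (J (H w2)) $ 1 $ 1 + 0 * matrix_inv (J (H w2)) $ 2 $ 1
        = b2 * (s * matrix_inv (J (H w2)) $ 1 $ 2 + 0 * matrix_inv (J (H w2)) $ 2 $ 2) \<and>
      0 \<le> s * matrix_inv (J (H w2)) $ 1 $ 2 + 0 * matrix_inv (J (H w2)) $ 2 $ 2 + 0"
    by (rule wedge_maximum [OF b2 ba(1) l(1,2) f_def]) blast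
  define N where "N = s * H w2 $ 1"
  have top: "s * H v $ 1 \<le> N" if "v \<in> wedge b2 l" for v
    using w2(2)[OF that] unfolding f_def N_def by simp
  have N: "T < N" "B < N" using top[OF l(3)] w'(2) by linarith+
  have notT: "\<not> \<bar>H w $ 1\<bar> \<le> T" if "N \<le> s * H w $ 1" for w
    using that N(1) s by auto
  have "w2 \<notin> axes"
  proof
    assume w: "w2 \<in> axes"
    have "N \<le> \<bar>H w2 $ 1\<bar>" unfolding N_def using s by auto
    also have "\<dots> \<le> B" using component_le_norm_cart[of "H w2" 1] B[OF w] H_axes[OF w] by simp
    finally show False using N(2) by simp
  qed
  define M where "M = matrix_inv (J (H w2))"
  have w2i: "w2 \<in> swept_interior b2" and row: "M $ 1 $ 1 = b2 * M $ 1 $ 2" and sM: "0 \<le> s * M $ 1 $ 2"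
    using w2(3)[OF \<open>w2 \<notin> axes\<close>] s0 unfolding M_def by auto
  define d where "d = s * (M $ 2 $ 1 - b2 * M $ 2 $ 2)"
  \<comment> \<open>The speed at which the image of the second line moves across its strip at the outermost point.\<close>
  have "d < 0"
  proof -
    have "det M * det (J (H w2)) = 1"
      using inverse_jacobian(1)[of "H w2"] det_mul[of M "J (H w2)"] unfolding M_def by simp
    then have "0 < det M" using det_pos[of "H w2"] by (metis zero_less_mult_pos2 zero_less_one)
    also have "det M = (s * s) * (M $ 1 $ 2 * (b2 * M $ 2 $ 2 - M $ 2 $ 1))"
      unfolding det_2 row ss by (simp add: algebra_simps)
    also have "\<dots> = (s * M $ 1 $ 2) * (- d)"
      unfolding d_def by (simp add: algebra_simps)
    finally show ?thesis using mult_nonneg_nonneg[OF sM, of d] by (cases "d < 0") simp_all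
  qed
  obtain w1 where w1: "w1 \<in> swept b1" "N \<le> s * H w1 $ 1" using esc(1) unfolding escapes_def by blast
  obtain w3 where w3: "w3 \<in> swept b3" "N \<le> s * H w3 $ 1" using esc(3) unfolding escapes_def by blast
  define p1 p2 p3 l1 l2 l3 where "p1 = w1 $ 1" and "p2 = w2 $ 1" and "p3 = w3 $ 1"
    and "l1 = w1 $ 2 + b1 * w1 $ 1" and "l2 = w2 $ 2 + b2 * w2 $ 1" and "l3 = w3 $ 2 + b3 * w3 $ 1"
  note pl_defs = p1_def p2_def p3_def l1_def l2_def l3_def
  have nn: "0 \<le> w1 $ 1" "0 \<le> w1 $ 2" "0 \<le> w2 $ 1" "0 \<le> w2 $ 2" "0 \<le> w3 $ 1" "0 \<le> w3 $ 2"
    using w1(1) w3(1) w2(1) unfolding swept_def wedge_def by auto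
  have lc: "l1 < crit b1" "l2 \<le> l" "l2 < crit b2" "l3 < crit b3"
    using w1(1) w3(1) w2(1) l(2) unfolding swept_def wedge_def pl_defs by auto
  have l_nonneg: "0 \<le> l1" "0 \<le> l2" "0 \<le> l3" using nn b1 b2 b(3) unfolding pl_defs by simp_all
  have w2s: "w2 \<in> swept b2" using w2i swept_interior_subset by blast
  \<comment> \<open>Each of the three points lies beyond the stopped lines of the neighbouring slopes.\<close>
  have "w2 \<notin> swept b1" using apart12[of w2] w2s notT[of w2] unfolding N_def by auto
  then have a1: "l1 < w2 $ 2 + b1 * w2 $ 1" using nn lc unfolding swept_def by auto
  have "w2 \<notin> swept b3" using apart23[of w2] w2s notT[of w2] unfolding N_def by auto
  then have a2: "l3 < w2 $ 2 + b3 * w2 $ 1" using nn lc unfolding swept_def by auto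
  have "w1 \<notin> swept b2" using apart12[of w1] w1 notT[of w1] by auto
  then have a3: "l2 < w1 $ 2 + b2 * w1 $ 1" using nn lc unfolding swept_def by auto
  have "w3 \<notin> swept b2" using apart23[of w3] w3 notT[of w3] by auto
  then have a4: "l2 < w3 $ 2 + b2 * w3 $ 1" using nn lc unfolding swept_def by auto
  define c e where "c = (l1 - l2) / (b1 - b2)" and "e = (l2 - l3) / (b2 - b3)"
  have c: "(b1 - b2) * c = l1 - l2" and e: "(b2 - b3) * e = l2 - l3"
    unfolding c_def e_def using b by simp_all
  have "(b1 - b2) * p1 < (b1 - b2) * c" "(b1 - b2) * c < (b1 - b2) * p2"
    "(b2 - b3) * p2 < (b2 - b3) * e" "(b2 - b3) * e < (b2 - b3) * p3"
    unfolding c e using a1 a2 a3 a4 unfolding pl_defs by (simp_all add: algebra_simps)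
  then have order: "p1 < c" "c < p2" "p2 < e" "e < p3" using b by simp_all
  \<comment> \<open>From left to right the path follows the steepest line, the middle one and the flattest one.\<close>
  define psi where "psi p = max (max (l1 - b1 * p) (l2 - b2 * p)) (l3 - b3 * p)" for p
  define pt where "pt p = (vector [p, psi p] :: real ^ 2)" for p
  have cmp: "p \<le> c \<Longrightarrow> l2 - b2 * p \<le> l1 - b1 * p" "c \<le> p \<Longrightarrow> l1 - b1 * p \<le> l2 - b2 * p"
    "p \<le> e \<Longrightarrow> l3 - b3 * p \<le> l2 - b2 * p" "e \<le> p \<Longrightarrow> l2 - b2 * p \<le> l3 - b3 * p" for p
    using mult_left_mono[of p c "b1 - b2"] mult_left_mono[of c p "b1 - b2"]
      mult_left_mono[of p e "b2 - b3"] mult_left_mono[of e p "b2 - b3"] b c e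
    by (simp_all add: algebra_simps)
  have psi1: "psi p = l1 - b1 * p" if "p \<le> c" for p
    using cmp(1)[OF that] cmp(3)[of p] that order unfolding psi_def by simp
  have psi2: "psi p = l2 - b2 * p" if "c \<le> p" "p \<le> e" for p
    using cmp(2)[of p] cmp(3)[of p] that unfolding psi_def by simp
  have psi3: "psi p = l3 - b3 * p" if "e \<le> p" for p
    using cmp(4)[of p] cmp(2)[of p] that order unfolding psi_def by simp
  have psi_nonneg: "0 \<le> psi p" if p: "p1 \<le> p" "p \<le> p3" for p
  proof (cases "p \<le> p2")
    case True
    then have "b2 * p \<le> b2 * p2" using b2 by (simp add: mult_left_mono)
    then have "0 \<le> l2 - b2 * p" using nn unfolding pl_defs by simp
    then show ?thesis unfolding psi_def by simp
  next
    case False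
    have "b3 * p \<le> b3 * p3" using p b by (simp add: mult_left_mono)
    then have "0 \<le> l3 - b3 * p" using nn unfolding pl_defs by simp
    then show ?thesis unfolding psi_def by simp
  qed
  have pt_pos: "0 \<le> pt p $ 1" "0 \<le> pt p $ 2" if "p1 \<le> p" "p \<le> p3" for p
    using psi_nonneg[OF that] that nn unfolding pt_def pl_defs by simp_all
  have pt1: "pt p \<in> wedge b1 l1" if "p1 \<le> p" "p \<le> c" for p
    using pt_pos[of p] that order psi1[of p] unfolding wedge_def pt_def by simp
  have pt2: "pt p \<in> wedge b2 l2" if "c \<le> p" "p \<le> e" for p
    using pt_pos[of p] that order psi2[of p] unfolding wedge_def pt_def by simp
  have pt3: "pt p \<in> wedge b3 l3" if "e \<le> p" "p \<le> p3" for p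
    using pt_pos[of p] that order psi3[of p] unfolding wedge_def pt_def by simp
  have sec1: "section_on G (wedge b1 l1) H" using section_wedge[OF b1] l_nonneg lc by blast
  have sec2: "section_on G (wedge b2 l2) H" using section_wedge[OF b2] l_nonneg lc by blast
  have sec3: "section_on G (wedge b3 l3) H" using section_wedge[OF b(3)] l_nonneg lc by blast
  have sw1: "pt p \<in> swept b1" if "p1 \<le> p" "p \<le> c" for p
    using pt1[OF that] wedge_subset_swept[OF lc(1)] by blast
  have sw2: "pt p \<in> swept b2" if "c \<le> p" "p \<le> e" for p
    using pt2[OF that] wedge_subset_swept[OF lc(3)] by blast
  have sw3: "pt p \<in> swept b3" if "e \<le> p" "p \<le> p3" for p
    using pt3[OF that] wedge_subset_swept[OF lc(4)] by blast
  have cpt: "continuous_on S pt" for S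
    unfolding pt_def psi_def by (intro continuous_on_vector_2 continuous_intros)
  have cont: "continuous_on {p1..p3} (\<lambda>p. H (pt p))"
  proof -
    have "continuous_on {p1..c} (\<lambda>p. H (pt p))"
      using sec1 pt1 unfolding section_on_def by (intro continuous_on_compose2 [OF _ cpt]) auto
    moreover have "continuous_on {c..e} (\<lambda>p. H (pt p))"
      using sec2 pt2 unfolding section_on_def by (intro continuous_on_compose2 [OF _ cpt]) auto
    moreover have "continuous_on {e..p3} (\<lambda>p. H (pt p))"
      using sec3 pt3 unfolding section_on_def by (intro continuous_on_compose2 [OF _ cpt]) auto
    ultimately have "continuous_on ({p1..c} \<union> {c..e} \<union> {e..p3}) (\<lambda>p. H (pt p))"
      by (intro continuous_on_closed_Un) auto
    moreover have "{p1..c} \<union> {c..e} \<union> {e..p3} = {p1..p3}" using order by auto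
    ultimately show ?thesis by simp
  qed
  have GH: "G (H (pt p)) = pt p" if "p1 \<le> p" "p \<le> p3" for p
    using sec1 sec2 sec3 pt1[of p] pt2[of p] pt3[of p] that unfolding section_on_def
    by (metis linear)
  define X where "X p = s * H (pt p) $ 1" for p
  define Y where "Y p = s * H (pt p) $ 2" for p
  have cX: "continuous_on {p1..p3} X" unfolding X_def by (intro continuous_intros cont)
  have ptw: "pt p1 = w1" "pt p2 = w2" "pt p3 = w3"
    using psi1[of p1] psi2[of p2] psi3[of p3] order unfolding pt_def pl_defs
    by (simp_all add: vec_eq_iff forall_2)
  have Xc: "X c \<le> N" and Xe: "X e \<le> N"
    using apart12[OF sw1 sw2, of c] apart23[OF sw2 sw3, of e] order N s unfolding X_def by auto
  \<comment> \<open>The middle segment lies in the wedge over which \<open>w2\<close> is outermost.\<close>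
  have Xmid: "X p \<le> N" if "c \<le> p" "p \<le> e" for p
    using top[of "pt p"] pt2[OF that] wedge_mono[OF lc(2)] unfolding X_def by blast
  have X1: "N \<le> X p1" and X2: "X p2 = N" and X3: "N \<le> X p3"
    unfolding X_def ptw N_def[symmetric] using w1 w3 by simp_all
  obtain u1 where u1: "p1 \<le> u1" "u1 \<le> c" "X u1 = N" "\<And>t. u1 \<le> t \<Longrightarrow> t \<le> c \<Longrightarrow> X t \<le> N"
    by (rule last_crossing [OF less_imp_le [OF order(1)] _ X1 Xc])
       (use continuous_on_subset [OF cX] order in auto)
  obtain u3 where u3: "e \<le> u3" "u3 \<le> p3" "X u3 = N" "\<And>t. e \<le> t \<Longrightarrow> t \<le> u3 \<Longrightarrow> X t \<le> N"
    by (rule first_crossing [OF less_imp_le [OF order(4)] _ Xe X3])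
       (use continuous_on_subset [OF cX] order in auto)
  have XN: "X p \<le> N" if "u1 \<le> p" "p \<le> u3" for p
    using u1(4)[of p] u3(4)[of p] Xmid[of p] that by linarith
  have Yu1: "\<bar>Y u1 + b1 * N\<bar> \<le> C"
  proof -
    have "Y u1 + b1 * N = s * (H (pt u1) $ 2 + b1 * H (pt u1) $ 1)"
      unfolding u1(3)[symmetric] X_def Y_def by (simp add: algebra_simps)
    then show ?thesis using C[OF sw1[OF u1(1,2)]] s1 by (simp add: abs_mult)
  qed
  have Yp2: "\<bar>Y p2 + b2 * N\<bar> \<le> C"
  proof -
    have "Y p2 + b2 * N = s * (H (pt p2) $ 2 + b2 * H (pt p2) $ 1)"
      unfolding X2[symmetric] X_def Y_def by (simp add: algebra_simps)
    then show ?thesis using C'[OF sw2[of p2]] order s1 by (simp add: abs_mult)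
  qed
  have Yu3: "\<bar>Y u3 + b3 * N\<bar> \<le> C"
  proof -
    have "Y u3 + b3 * N = s * (H (pt u3) $ 2 + b3 * H (pt u3) $ 1)"
      unfolding u3(3)[symmetric] X_def Y_def by (simp add: algebra_simps)
    then show ?thesis using C''[OF sw3[OF u3(1,2)]] s1 by (simp add: abs_mult)
  qed
  have C0: "0 \<le> C" unfolding C_def by simp
  then have "0 \<le> T" unfolding T_def using g by simp
  then have N0: "0 < N" using N by linarith
  have gN: "2 * C < g * N" using N(1) g unfolding T_def by (simp add: pos_divide_less_eq mult.commute)
  have "g * N \<le> (b1 - b2) * N" "g * N \<le> (b2 - b3) * N"
    using g N0 by (intro mult_right_mono; simp)+
  then have YY: "Y u1 < Y p2" "Y p2 < Y u3"
    using Yu1 Yp2 Yu3 gN by (simp_all add: algebra_simps abs_le_iff)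
  \<comment> \<open>Turned by a right angle, so that distance \<open>N\<close> becomes the horizontal axis.\<close>
  define \<gamma> where "\<gamma> p = (vector [Y p, N - X p] :: real ^ 2)" for p
  have derY: "(Y has_real_derivative d) (at p2)"
  proof -
    define ln where "ln p = vector [0, l2] + p *\<^sub>R (vector [1, - b2] :: real ^ 2)" for p :: real
    have ln2: "ln p2 = w2" unfolding ln_def pl_defs by (simp add: vec_eq_iff forall_2)
    have "(ln has_derivative (\<lambda>t. t *\<^sub>R vector [1, - b2])) (at p2)"
      unfolding ln_def by (auto intro!: derivative_eq_intros)
    moreover have "(H has_derivative (\<lambda>h. M *v h)) (at (ln p2))"
      unfolding ln2 M_def by (rule H_has_derivative [OF b2 w2i])
    ultimately have "((\<lambda>p. H (ln p)) has_derivative (\<lambda>t. M *v (t *\<^sub>R vector [1, - b2]))) (at p2)"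
      using diff_chain_at [of ln _ p2 H] by (simp add: o_def)
    then have "((\<lambda>p. H (ln p) $ 2) has_derivative (\<lambda>t. (M *v (t *\<^sub>R vector [1, - b2])) $ 2)) (at p2)"
      by (rule bounded_linear.has_derivative [OF bounded_linear_vec_nth])
    then have "((\<lambda>p. s * H (ln p) $ 2) has_derivative (\<lambda>t. s * (M *v (t *\<^sub>R vector [1, - b2])) $ 2)) (at p2)"
      by (rule has_derivative_mult_right)
    moreover have "(\<lambda>t. s * (M *v (t *\<^sub>R vector [1, - b2])) $ 2) = (*) d"
      unfolding d_def by (auto simp: fun_eq_iff matrix_vector_mult_def sum_2 algebra_simps)
    ultimately have derL: "((\<lambda>p. s * H (ln p) $ 2) has_real_derivative d) (at p2)"
      by (simp add: has_field_derivative_def)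
    have eqY: "s * H (ln p) $ 2 = Y p" if "p \<in> {c<..<e}" for p
    proof -
      have "ln p = pt p" using psi2[of p] that unfolding ln_def pt_def by (simp add: vec_eq_iff forall_2)
      then show ?thesis unfolding Y_def by simp
    qed
    show ?thesis
      by (rule has_field_derivative_transform_within_open [OF derL open_greaterThanLessThan _ eqY])
         (use order in auto)
  qed
  show False
  proof (rule no_backward_contact [of u1 p2 u3 \<gamma> d])
    show "u1 < p2" "p2 < u3" using u1 u3 order by linarith+
    have sub: "{u1..u3} \<subseteq> {p1..p3}" using u1 u3 by auto
    have "continuous_on {p1..p3} \<gamma>"
      unfolding \<gamma>_def X_def Y_def by (intro continuous_on_vector_2 continuous_intros cont)
    then show "continuous_on {u1..u3} \<gamma>" using sub continuous_on_subset by blast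
    show "inj_on \<gamma> {u1..u3}"
    proof (rule inj_onI)
      fix p q assume pq: "p \<in> {u1..u3}" "q \<in> {u1..u3}" "\<gamma> p = \<gamma> q"
      then have "H (pt p) = H (pt q)"
        using s0 unfolding \<gamma>_def X_def Y_def by (simp add: vec_eq_iff forall_2)
      then have "G (H (pt p)) = G (H (pt q))" by (rule arg_cong)
      moreover have "p1 \<le> p" "p \<le> p3" "p1 \<le> q" "q \<le> p3" using pq(1,2) sub by auto
      ultimately have "pt p = pt q" unfolding GH[OF \<open>p1 \<le> p\<close> \<open>p \<le> p3\<close>] GH[OF \<open>p1 \<le> q\<close> \<open>q \<le> p3\<close>] by simp
      then show "p = q" unfolding pt_def by (simp add: vec_eq_iff forall_2)
    qed
    show "\<And>p. p \<in> {u1..u3} \<Longrightarrow> 0 \<le> \<gamma> p $ 2" using XN unfolding \<gamma>_def by simp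
  qed (use YY u1(3) u3(3) X2 derY \<open>d < 0\<close> in \<open>simp_all add: \<gamma>_def\<close>)
qed

end

section \<open>Injectivity under a real spectral gap\<close>

definition matrix_of_columns :: "real ^ 2 \<Rightarrow> real ^ 2 \<Rightarrow> real ^ 2 ^ 2" where
  "matrix_of_columns x y = transpose (vector [x, y])"

lemma matrix_of_columns_mult: "matrix_of_columns x y *v h = h $ 1 *\<^sub>R x + h $ 2 *\<^sub>R y"
  by (simp add: matrix_of_columns_def transpose_def matrix_vector_mult_def vec_eq_iff sum_2 mult.commute)

lemma collinear_if_det_of_columns_0:
  assumes "det (matrix_of_columns (u - v) (w - v)) = 0"
  shows "collinear {u, v, w}"
proof -
  define x y where "x = u - v" and "y = w - v"
  have d: "x $ 1 * y $ 2 = y $ 1 * x $ 2"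
    using assms unfolding x_def [symmetric] y_def [symmetric]
    by (simp add: matrix_of_columns_def det_2 transpose_def)
  have "x = 0 \<or> y = 0 \<or> (\<exists>c. y = c *\<^sub>R x)"
  proof (cases "x = 0")
    case False
    then have "x $ 1 \<noteq> 0 \<or> x $ 2 \<noteq> 0" by (auto simp: vec_eq_iff forall_2)
    then consider "x $ 1 \<noteq> 0" | "x $ 2 \<noteq> 0" by blast
    then show ?thesis
    proof cases
      case 1
      then have "y = (y $ 1 / x $ 1) *\<^sub>R x" using d by (simp add: vec_eq_iff forall_2 field_simps)
      then show ?thesis by blast
    next
      case 2
      then have "y = (y $ 2 / x $ 2) *\<^sub>R x" using d by (simp add: vec_eq_iff forall_2 field_simps)
      then show ?thesis by blast
    qed
  qed simp
  then have "collinear {0, u - v, w - v}" unfolding collinear_lemma x_def y_def .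
  then show ?thesis by (subst collinear_3) simp_all
qed

lemma continuous_on_conjugated_matrix:
  assumes "continuous_on S (J :: real ^ 2 \<Rightarrow> real ^ 2 ^ 2)"
  shows "continuous_on S (\<lambda>x. A ** J x ** B)"
proof -
  have J: "continuous_on S (\<lambda>x. J x $ i $ j)" for i j
    using assms by (intro continuous_intros)
  show ?thesis
    unfolding matrix_matrix_mult_def vec_lambda_beta
    by (intro continuous_on_vec_lambda continuous_intros J)
qed

text \<open>Conjugation by a linear map changes neither the determinant nor the eigenvalues of the Jacobian
  matrix, so both planes may be given the affine coordinates in which two sides of a triangle lie on
  the axes.\<close>

lemma (in real_spectral_gap) conjugate_spectral_gap:
  assumes A: "A ** A' = mat 1" "A' ** A = mat 1"
  shows "real_spectral_gap (\<lambda>x. A' *v (G (A *v x) - v)) (\<lambda>x. A' ** J (A *v x) ** A) \<delta>"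
proof
  fix x
  have "((\<lambda>x. A *v x) has_derivative (\<lambda>h. A *v h)) (at x)"
    by (rule bounded_linear_imp_has_derivative) (rule matrix_vector_mul_bounded_linear)
  from diff_chain_at [OF this deriv]
  have "((\<lambda>x. G (A *v x) - v) has_derivative (\<lambda>h. J (A *v x) *v (A *v h))) (at x)"
    by (auto simp: o_def intro!: derivative_eq_intros)
  from bounded_linear.has_derivative [OF matrix_vector_mul_bounded_linear [of A'] this]
  show "((\<lambda>x. A' *v (G (A *v x) - v)) has_derivative (\<lambda>h. (A' ** J (A *v x) ** A) *v h)) (at x)"
    by (simp add: matrix_vector_mul_assoc matrix_mul_assoc)
next
  have "continuous_on UNIV (\<lambda>x. J (A *v x))"
    by (rule continuous_on_compose2 [OF cont_J]) (auto intro: matrix_vector_mult_linear_continuous_on)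
  then show "continuous_on UNIV (\<lambda>x. A' ** J (A *v x) ** A)"
    by (rule continuous_on_conjugated_matrix)
next
  have one: "det A' * det A = 1" using det_mul[of A' A] A(2) by simp
  have conj: "det (A' ** M ** A) = det M" for M
    using one by (simp add: det_mul mult.commute mult.left_commute)
  fix x show "0 < det (A' ** J (A *v x) ** A)" unfolding conj by (rule det_pos)
  fix \<mu> :: real assume mu: "\<bar>\<mu>\<bar> < \<delta>"
  have "A' ** (J (A *v x) - mat \<mu>) ** A = A' ** J (A *v x) ** A - A' ** mat \<mu> ** A"
    by (simp add: matrix_eq matrix_vector_mult_diff_rdistrib matrix_vector_mult_diff_distrib
        flip: matrix_vector_mul_assoc)
  moreover have "A' ** mat \<mu> ** A = mat \<mu>"
  proof -
    have "mat \<mu> *v h = \<mu> *\<^sub>R h" for h :: "real ^ 2"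
      by (simp add: matrix_vector_mult_def mat_def vec_eq_iff sum_2 forall_2)
    moreover have "A' *v (A *v h) = h" for h by (simp add: matrix_vector_mul_assoc A)
    ultimately show ?thesis
      by (simp add: matrix_eq matrix_vector_mult_scaleR flip: matrix_vector_mul_assoc)
  qed
  ultimately show "det (A' ** J (A *v x) ** A - mat \<mu>) \<noteq> 0"
    using gap[OF mu, of "A *v x"] conj by metis
qed (rule gap_pos)

text \<open>The two sides of an unfillable triangle are first lengthened by the factor \<open>1 + k\<close>, over which the
  section still extends; the lengthened sides become the unit segments of the axes, and the triangle
  becomes the wedge with \<open>a = 1 / (1 + k)\<close>.\<close>

theorem (in real_spectral_gap) inj_G: "inj G"
proof (rule ccontr)
  assume "\<not> inj G"
  obtain u v w H where ncol: "\<not> collinear {u, v, w}"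
    and H: "section_on G (closed_segment v u \<union> closed_segment v w) H"
    and nofill: "\<And>K. section_on G (convex hull {u, v, w}) K \<Longrightarrow> K v \<noteq> H v"
    by (rule unfillable_triangle [OF locally_injective_G cont_G \<open>\<not> inj G\<close>]) blast
  have comp: "compact (closed_segment v u \<union> closed_segment v w)" by (intro compact_Un compact_segment)
  obtain U L where U: "open U" "closed_segment v u \<union> closed_segment v w \<subseteq> U" "section_on G U L"
    "\<And>z. z \<in> closed_segment v u \<union> closed_segment v w \<Longrightarrow> L z = H z"
    by (rule section_extends_to_open [OF locally_injective_G cont_G comp H]) blast
  have "u \<in> U" "w \<in> U" using U(2) by auto
  then obtain r1 r2 where r12: "r1 > 0" "ball u r1 \<subseteq> U" "r2 > 0" "ball w r2 \<subseteq> U"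
    using U(1) unfolding open_contains_ball by blast
  define r where "r = min r1 r2"
  have r: "r > 0" "ball u r \<subseteq> U" "ball w r \<subseteq> U"
    using r12 unfolding r_def by (auto simp: subset_iff)
  define k where "k = r / (1 + norm (u - v) + norm (w - v))"
  have den: "0 < 1 + norm (u - v) + norm (w - v)" by (simp add: add_pos_nonneg)
  have k: "0 < k" unfolding k_def using r(1) den by simp
  have kn: "k * norm (u - v) < r" "k * norm (w - v) < r"
  proof -
    have "k * (1 + norm (u - v) + norm (w - v)) = r" unfolding k_def using den by simp
    then show "k * norm (u - v) < r" "k * norm (w - v) < r"
      using k mult_nonneg_nonneg [OF less_imp_le [OF k] norm_ge_zero [of "u - v"]]
        mult_nonneg_nonneg [OF less_imp_le [OF k] norm_ge_zero [of "w - v"]]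
      unfolding distrib_left by linarith+
  qed
  have reach: "v + t *\<^sub>R ((1 + k) *\<^sub>R (x - v)) \<in> U"
    if x: "closed_segment v x \<subseteq> U" "ball x r \<subseteq> U" "k * norm (x - v) < r" and t: "0 \<le> t" "t \<le> 1" for x t
  proof (cases "t * (1 + k) \<le> 1")
    case True
    have "v + t *\<^sub>R ((1 + k) *\<^sub>R (x - v)) = (1 - t * (1 + k)) *\<^sub>R v + (t * (1 + k)) *\<^sub>R x"
      by (simp add: algebra_simps)
    then have "v + t *\<^sub>R ((1 + k) *\<^sub>R (x - v)) \<in> closed_segment v x"
      unfolding in_segment using True t k by (intro exI[of _ "t * (1 + k)"]) auto
    then show ?thesis using x by blast
  next
    case False
    have "t * (1 + k) \<le> 1 * (1 + k)" using t k by (intro mult_right_mono) auto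
    then have "\<bar>t * (1 + k) - 1\<bar> \<le> k" using False by simp
    moreover have "v + t *\<^sub>R ((1 + k) *\<^sub>R (x - v)) - x = (t * (1 + k) - 1) *\<^sub>R (x - v)"
      by (simp add: algebra_simps)
    ultimately have "norm (v + t *\<^sub>R ((1 + k) *\<^sub>R (x - v)) - x) \<le> k * norm (x - v)"
      by (simp add: mult_right_mono)
    then have "v + t *\<^sub>R ((1 + k) *\<^sub>R (x - v)) \<in> ball x r"
      using x(3) by (simp add: dist_norm norm_minus_commute)
    then show ?thesis using x by blast
  qed
  define A where "A = (1 + k) *\<^sub>R matrix_of_columns (u - v) (w - v)"
  have Amult: "A *v h = h $ 1 *\<^sub>R ((1 + k) *\<^sub>R (u - v)) + h $ 2 *\<^sub>R ((1 + k) *\<^sub>R (w - v))" for h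
    unfolding A_def scaleR_matrix_vector_assoc [symmetric] matrix_of_columns_mult
    by (simp add: algebra_simps)
  have "det A \<noteq> 0"
  proof -
    have "det (matrix_of_columns (u - v) (w - v)) \<noteq> 0" using collinear_if_det_of_columns_0 ncol by blast
    moreover have "det A = (1 + k) * (1 + k) * det (matrix_of_columns (u - v) (w - v))"
      unfolding A_def det_2 by (simp add: algebra_simps)
    ultimately show ?thesis using k by simp
  qed
  then obtain A' where A: "A ** A' = mat 1" "A' ** A = mat 1"
    by (metis invertible_det_nz invertible_def)
  have AA: "A *v (A' *v h) = h" "A' *v (A *v h) = h" for h by (simp_all add: matrix_vector_mul_assoc A)
  define a where "a = 1 / (1 + k)"
  have a: "0 < a" "a < 1" "a * (1 + k) = 1" unfolding a_def using k by simp_all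
  interpret N: real_spectral_gap "\<lambda>x. A' *v (G (A *v x) - v)" "\<lambda>x. A' ** J (A *v x) ** A" \<delta>
    by (rule conjugate_spectral_gap [OF A])
  have Uax: "v + A *v x \<in> U" if x: "x \<in> axes" for x
  proof (cases "x $ 1 = 0")
    case True
    then show ?thesis using reach[of w "x $ 2"] x U(2) r kn unfolding Amult axes_def by auto
  next
    case False
    then show ?thesis using reach[of u "x $ 1"] x U(2) r kn unfolding Amult axes_def by auto
  qed
  interpret B: blocked_wedge "\<lambda>x. A' *v (G (A *v x) - v)" "\<lambda>x. A' ** J (A *v x) ** A" \<delta>
    "\<lambda>x. A' *v L (v + A *v x)" a
  proof
    have cL: "continuous_on U L" and GL: "\<And>z. z \<in> U \<Longrightarrow> G (L z) = z"
      using U(3) unfolding section_on_def by blast+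
    have "continuous_on axes (\<lambda>x. v + A *v x)"
      by (intro continuous_intros matrix_vector_mult_linear_continuous_on)
    then have "continuous_on axes (\<lambda>x. L (v + A *v x))"
      by (rule continuous_on_compose2 [OF cL]) (use Uax in blast)
    then have "continuous_on axes (\<lambda>x. A' *v L (v + A *v x))"
      by (rule continuous_on_compose2 [OF matrix_vector_mult_linear_continuous_on]) auto
    moreover have "A' *v (G (A *v (A' *v L (v + A *v x))) - v) = x" if "x \<in> axes" for x
      unfolding AA GL [OF Uax [OF that]] by (simp add: AA)
    ultimately show "section_on (\<lambda>x. A' *v (G (A *v x) - v)) axes (\<lambda>x. A' *v L (v + A *v x))"
      unfolding section_on_def by blast
    show "0 < a" "a < 1" by (rule a)+
    fix K assume K: "section_on (\<lambda>x. A' *v (G (A *v x) - v)) (wedge 1 a) K"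
    then have cK: "continuous_on (wedge 1 a) K"
      and GK: "\<And>x. x \<in> wedge 1 a \<Longrightarrow> A' *v (G (A *v K x) - v) = x"
      unfolding section_on_def by blast+
    define K' where "K' y = A *v K (A' *v (y - v))" for y
    have mem: "A' *v (y - v) \<in> wedge 1 a" if "y \<in> convex hull {u, v, w}" for y
    proof -
      obtain p q s where pqs: "0 \<le> p" "0 \<le> q" "0 \<le> s" "p + q + s = 1"
        "y = p *\<^sub>R u + q *\<^sub>R v + s *\<^sub>R w"
        using \<open>y \<in> convex hull {u, v, w}\<close> unfolding convex_hull_3 by blast
      have q: "q = 1 - p - s" using pqs(4) by simp
      have one: "(a * p) *\<^sub>R ((1 + k) *\<^sub>R z) = p *\<^sub>R z" for p and z :: "real ^ 2"
        using a(3) by (metis mult.assoc mult.commute mult.right_neutral scaleR_scaleR)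
      have "y - v = p *\<^sub>R (u - v) + s *\<^sub>R (w - v)"
        unfolding pqs(5) q by (simp add: algebra_simps)
      also have "\<dots> = A *v vector [a * p, a * s]" unfolding Amult by (simp only: vector_2 one)
      finally have "A' *v (y - v) = vector [a * p, a * s]" by (simp add: AA)
      moreover have "a * s + a * p \<le> a"
        using pqs a(1) mult_left_mono[of "s + p" 1 a] by (simp add: algebra_simps)
      ultimately show ?thesis unfolding wedge_def using pqs a(1) by simp
    qed
    have c1: "continuous_on (convex hull {u, v, w}) (\<lambda>y. A' *v (y - v))"
      by (rule continuous_on_compose2 [OF matrix_vector_mult_linear_continuous_on]) (auto intro: continuous_intros)
    then have "continuous_on (convex hull {u, v, w}) (\<lambda>y. K (A' *v (y - v)))"
      by (rule continuous_on_compose2 [OF cK]) (use mem in blast)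
    then have "continuous_on (convex hull {u, v, w}) K'"
      unfolding K'_def by (rule continuous_on_compose2 [OF matrix_vector_mult_linear_continuous_on]) auto
    moreover have "G (K' y) = y" if y: "y \<in> convex hull {u, v, w}" for y
    proof -
      have "A' *v (G (K' y) - v) = A' *v (y - v)"
        unfolding K'_def by (rule GK [OF mem [OF y]])
      then have "A *v (A' *v (G (K' y) - v)) = A *v (A' *v (y - v))" by simp
      then show ?thesis unfolding AA by simp
    qed
    ultimately have "section_on G (convex hull {u, v, w}) K'" unfolding section_on_def by blast
    then have "K' v \<noteq> H v" by (rule nofill)
    moreover have "L (v + A *v 0) = H v" using U(4)[of v] by simp
    ultimately show "K 0 \<noteq> A' *v L (v + A *v 0)" unfolding K'_def by (auto simp: AA)
  qed
  show False by (rule B.no_blocked_wedge)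
qed

section \<open>Traces that omit a value\<close>

text \<open>The hypothesis on \<open>z\<close> says that \<open>z\<close> is a root of the characteristic polynomial. An eigenvector is a
  column of the adjugate of \<open>A - z\<close>, up to sign; if the first choices vanish then \<open>(0, 1)\<close> is one.\<close>

lemma eigenvalue_of_trace:
  fixes A :: "real ^ 2 ^ 2" and z :: complex
  assumes det: "det A = 1" and z: "z * z + 1 = of_real (A $ 1 $ 1 + A $ 2 $ 2) * z"
  shows "complex_eigenvalue A z"
proof -
  define p q r s where "p = complex_of_real (A $ 1 $ 1)" and "q = complex_of_real (A $ 1 $ 2)"
    and "r = complex_of_real (A $ 2 $ 1)" and "s = complex_of_real (A $ 2 $ 2)"
  have d: "p * s - q * r = 1"
    using arg_cong [OF det, of complex_of_real] unfolding det_2 p_def q_def r_def s_def by simp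
  have char: "(z - p) * (z - s) = q * r"
    using d z unfolding p_def [symmetric] s_def [symmetric] of_real_add by algebra
  have eig: "complex_eigenvalue A z" if "v \<noteq> 0" "p * v $ 1 + q * v $ 2 = z * v $ 1"
    "r * v $ 1 + s * v $ 2 = z * v $ 2" for v :: "complex ^ 2"
    unfolding complex_eigenvalue_def
  proof (intro exI conjI)
    show "map_matrix complex_of_real A *v v = z *s v"
      using that(2,3) unfolding p_def q_def r_def s_def
      by (simp add: vec_eq_iff forall_2 matrix_vector_mult_def sum_2 map_matrix_def)
  qed (rule that(1))
  show ?thesis
  proof (cases "q = 0 \<and> z = s")
    case True
    show ?thesis by (rule eig [of "vector [0, 1]"]) (use True in \<open>auto simp: vec_eq_iff forall_2\<close>)
  next
    case False
    show ?thesis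
    proof (cases "q = 0")
      case True
      then have "z = p" using char False by auto
      show ?thesis
        by (rule eig [of "vector [z - s, r]"])
           (use True False \<open>z = p\<close> in \<open>auto simp: vec_eq_iff forall_2 algebra_simps\<close>)
    next
      case q: False
      have "r * q + s * (z - p) = z * (z - p)" using char by algebra
      then show ?thesis
        by (intro eig [of "vector [q, z - p]"])
           (use q in \<open>auto simp: vec_eq_iff forall_2 algebra_simps\<close>)
    qed
  qed
qed

lemma real_reciprocal_sum:
  assumes "z \<in> complex_of_real ` {..<0} \<union> sphere 0 1 \<union> complex_of_real ` {0<..}"
  obtains c :: real where "z * z + 1 = of_real c * z"
proof -
  consider x where "z = complex_of_real x" "x \<noteq> 0" | "norm z = 1" using assms by auto
  then show thesis
  proof cases
    case (1 x)
    have "z * z + 1 = of_real (x * x + 1)" unfolding 1(1) by simp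
    also have "\<dots> = of_real ((x + 1 / x) * x)" using 1(2) by (simp add: field_simps)
    also have "\<dots> = of_real (x + 1 / x) * z" unfolding 1(1) by (rule of_real_mult)
    finally show thesis by (rule that)
  next
    case 2
    then have "z * cnj z = 1" by (simp add: complex_norm_square [symmetric] flip: power2_eq_square)
    then have "z * z + 1 = (z + cnj z) * z" by (simp add: algebra_simps)
    also have "\<dots> = of_real (2 * Re z) * z" unfolding complex_add_cnj ..
    finally show thesis by (rule that)
  qed
qed

text \<open>Keep \<open>a\<close> fixed and solve \<open>F y - s y = F a - s a\<close> for \<open>y\<close> near \<open>b\<close>: with the local inverse \<open>H\<close> of \<open>F\<close>
  at \<open>b\<close> this is the fixed point equation \<open>y = H (F b + s (y - a))\<close>, and for small \<open>s\<close> the right-hand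
  side maps a small ball around \<open>b\<close> into itself.\<close>

lemma coincidence_persists:
  fixes F :: "'a::euclidean_space \<Rightarrow> 'a"
  assumes G: "locally_injective F" and cont: "continuous_on UNIV F"
    and ab: "a \<noteq> b" "F a = F b"
  obtains s0 where "s0 > 0"
    "\<And>s. 0 < s \<Longrightarrow> s \<le> s0 \<Longrightarrow> \<not> inj (\<lambda>x. F x - s *\<^sub>R x)"
proof -
  obtain T \<rho> H where T: "open T" "b \<in> T" "\<rho> > 0" "F ` T \<subseteq> ball (F b) \<rho>"
    "section_on F (ball (F b) \<rho>) H" "\<And>y. y \<in> T \<Longrightarrow> H (F y) = y"
    by (rule locally_injective_local_section [OF G cont, of b]) blast
  define r where "r = dist a b / 2"
  have r: "0 < r" "r < dist a b" unfolding r_def using ab by simp_all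
  have cH: "continuous_on (ball (F b) \<rho>) H" and FH: "\<And>w. w \<in> ball (F b) \<rho> \<Longrightarrow> F (H w) = w"
    using T(5) unfolding section_on_def by blast+
  have "isCont H (F b)" using cH T(3) by (simp add: continuous_on_eq_continuous_at)
  then obtain e where e: "e > 0" "\<And>w. dist w (F b) < e \<Longrightarrow> dist (H w) (H (F b)) < r"
    unfolding continuous_at_eps_delta using r(1) by blast
  have Hb: "H (F b) = b" using T(2,6) by blast
  define e' where "e' = min e \<rho>"
  have e': "0 < e'" "e' \<le> e" "e' \<le> \<rho>" unfolding e'_def using e(1) T(3) by auto
  define s0 where "s0 = e' / (1 + r + dist a b)"
  have den: "0 < 1 + r + dist a b" using r by linarith
  have s0: "0 < s0" unfolding s0_def using den e' by simp
  have "\<not> inj (\<lambda>x. F x - s *\<^sub>R x)" if s: "0 < s" "s \<le> s0" for s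
  proof -
    define m where "m y = F b + s *\<^sub>R (y - a)" for y
    have near: "dist (m y) (F b) < e'" if y: "y \<in> cball b r" for y
    proof -
      have "dist (m y) (F b) = s * dist y a" unfolding m_def using s by (simp add: dist_norm)
      also have "\<dots> \<le> s * (r + dist a b)"
        using y s dist_triangle[of y a b] by (intro mult_left_mono) (auto simp: dist_commute)
      also have "\<dots> \<le> s0 * (r + dist a b)" using s r by (intro mult_right_mono) auto
      also have "\<dots> < s0 * (1 + r + dist a b)" using s0 by simp
      also have "\<dots> = e'" unfolding s0_def using den by simp
      finally show ?thesis .
    qed
    have mem: "m y \<in> ball (F b) \<rho>" if "y \<in> cball b r" for y
      using near[OF that] e' by (simp add: dist_commute)
    have "continuous_on (cball b r) m" unfolding m_def by (intro continuous_intros)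
    then have "continuous_on (cball b r) (\<lambda>y. H (m y))"
      by (rule continuous_on_compose2 [OF cH]) (use mem in blast)
    moreover have "(\<lambda>y. H (m y)) \<in> cball b r \<rightarrow> cball b r"
    proof
      fix y assume "y \<in> cball b r"
      then have "dist (H (m y)) b < r" using e(2)[of "m y"] near[of y] e' Hb by simp
      then show "H (m y) \<in> cball b r" by (simp add: dist_commute)
    qed
    ultimately obtain y where y: "y \<in> cball b r" "H (m y) = y"
      using brouwer_ball [OF r(1), of b "\<lambda>y. H (m y)"] by blast
    have "F y = m y" using FH[OF mem[OF y(1)]] y(2) by simp
    then have "F y - s *\<^sub>R y = F a - s *\<^sub>R a" unfolding m_def ab(2) by (simp add: algebra_simps)
    moreover have "y \<noteq> a" using y(1) r(2) by (auto simp: dist_commute)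
    ultimately show ?thesis by (meson injD)
  qed
  then show thesis using that s0 by blast
qed

text \<open>The characteristic polynomial at \<open>\<nu> > 0\<close> is \<open>1 - \<nu> t + \<nu>\<^sup>2 > 1 - \<nu> c\<close>, which is positive for
  \<open>\<nu> < 1/c\<close> when \<open>c > 0\<close>. For \<open>s \<le> 1/(2c)\<close> the eigenvalues \<open>\<mu>\<close> of the Jacobian matrix of \<open>F - s id\<close>
  correspond to \<open>\<nu> = s + \<mu>\<close>, and \<open>\<bar>\<mu>\<bar> < s\<close> puts \<open>\<nu>\<close> into this range.\<close>

lemma inj_if_trace_bounded_above:
  fixes F :: "real ^ 2 \<Rightarrow> real ^ 2" and J :: "real ^ 2 \<Rightarrow> real ^ 2 ^ 2"
  assumes der: "\<And>x. (F has_derivative (\<lambda>h. J x *v h)) (at x)" and cont: "continuous_on UNIV J"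
    and det: "\<And>x. det (J x) = 1" and tr: "\<And>x. J x $ 1 $ 1 + J x $ 2 $ 2 < c"
  shows "inj F"
proof (rule ccontr)
  assume "\<not> inj F"
  then obtain a b where ab: "a \<noteq> b" "F a = F b" unfolding inj_def by blast
  define c' where "c' = max c 1"
  have c': "c \<le> c'" "1 \<le> c'" unfolding c'_def by auto
  have char: "0 < det (J x - mat \<nu>)" if \<nu>: "0 < \<nu>" "\<nu> * c' < 1" for x \<nu>
  proof -
    have "\<nu> * (J x $ 1 $ 1 + J x $ 2 $ 2) \<le> \<nu> * c'"
      using tr[of x] c' \<nu> by (intro mult_left_mono) auto
    then have "0 < 1 - \<nu> * (J x $ 1 $ 1 + J x $ 2 $ 2) + \<nu> * \<nu>"
      using \<nu> mult_pos_pos [OF \<nu>(1) \<nu>(1)] by linarith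
    also have "\<dots> = det (J x - mat \<nu>)"
      unfolding det[of x, symmetric] by (simp add: det_2 mat_def algebra_simps)
    finally show ?thesis .
  qed
  have gap: "real_spectral_gap (\<lambda>x. F x - s *\<^sub>R x) (\<lambda>x. J x - mat s) s" if s: "0 < s" "2 * s * c' \<le> 1" for s
  proof
    have mat: "mat s *v h = s *\<^sub>R h" for h :: "real ^ 2"
      by (simp add: matrix_vector_mult_def mat_def vec_eq_iff sum_2 forall_2)
    fix x show "((\<lambda>x. F x - s *\<^sub>R x) has_derivative (\<lambda>h. (J x - mat s) *v h)) (at x)"
      unfolding matrix_vector_mult_diff_rdistrib mat
      by (intro has_derivative_diff der has_derivative_scaleR_right has_derivative_ident)
    have sc: "0 < s * c'" using s c' by simp
    show "0 < det (J x - mat s)" using char[of s x] s sc by simp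
    fix \<mu> :: real assume mu: "\<bar>\<mu>\<bar> < s"
    have "(s + \<mu>) * c' < 2 * s * c'" using mu c' by (intro mult_strict_right_mono) auto
    then have "0 < det (J x - mat (s + \<mu>))" using char[of "s + \<mu>" x] mu s by linarith
    moreover have "J x - mat s - mat \<mu> = J x - mat (s + \<mu>)" by (simp add: mat_def vec_eq_iff)
    ultimately show "det (J x - mat s - mat \<mu>) \<noteq> 0" by (metis order_less_irrefl)
  next
    show "continuous_on UNIV (\<lambda>x. J x - mat s)" by (intro continuous_intros cont)
  qed (rule s(1))
  interpret positive_jacobian F J
    by unfold_locales (use der cont det in auto)
  obtain s0 where s0: "s0 > 0"
    "\<And>s. 0 < s \<Longrightarrow> s \<le> s0 \<Longrightarrow> \<not> inj (\<lambda>x. F x - s *\<^sub>R x)"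
    by (rule coincidence_persists [OF locally_injective_G cont_G ab]) blast
  define s where "s = min s0 (1 / (2 * c'))"
  have s: "0 < s" "s \<le> s0" "s \<le> 1 / (2 * c')" unfolding s_def using s0 c' by auto
  then have "2 * s * c' \<le> 1" using c' by (simp add: pos_le_divide_eq mult_ac)
  then show False using real_spectral_gap.inj_G [OF gap] s s0(2) by blast
qed

theorem corollary3:
  fixes F :: "real ^ 2 \<Rightarrow> real ^ 2"
  assumes "C1_map F"
    and "\<And>p. det (jacobian F (at p)) = 1"
    and "\<exists>z \<in> complex_of_real ` {..<0} \<union> sphere 0 1 \<union> complex_of_real ` {0<..}.
           \<forall>p. \<not> complex_eigenvalue (jacobian F (at p)) z"
  shows "inj F"
proof -
  define J where "J p = jacobian F (at p)" for p
  have der: "(F has_derivative (\<lambda>h. J x *v h)) (at x)" for x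
    using assms(1) unfolding C1_map_def J_def by (simp add: jacobian_works)
  have cont: "continuous_on UNIV J"
    using assms(1) unfolding C1_map_def J_def by simp
  have det: "det (J x) = 1" for x unfolding J_def by (rule assms(2))
  obtain z where z: "z \<in> complex_of_real ` {..<0} \<union> sphere 0 1 \<union> complex_of_real ` {0<..}"
    "\<And>p. \<not> complex_eigenvalue (J p) z" using assms(3) unfolding J_def by blast
  obtain c where c: "z * z + 1 = of_real c * z" by (rule real_reciprocal_sum [OF z(1)])
  define t where "t p = J p $ 1 $ 1 + J p $ 2 $ 2" for p
  have tc: "t p \<noteq> c" for p
    using eigenvalue_of_trace [OF det, of z p] z(2) c unfolding t_def by metis
  have "continuous_on UNIV t" unfolding t_def using cont by (intro continuous_intros)
  then have conn: "connected (range t)" by (rule connected_continuous_image [OF _ connected_UNIV])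
  have "(\<forall>p. t p < c) \<or> (\<forall>p. c < t p)"
  proof (rule ccontr)
    assume "\<not> ?thesis"
    then obtain p q where "t q \<le> c" "c \<le> t p" by (auto simp: not_less)
    then have "c \<in> range t" using connectedD_interval [OF conn] by blast
    then show False using tc by blast
  qed
  then show ?thesis
  proof
    assume "\<forall>p. t p < c"
    then show ?thesis using inj_if_trace_bounded_above [OF der cont det, of c] unfolding t_def by blast
  next
    assume t: "\<forall>p. c < t p"
    have "inj (\<lambda>x. - F x)"
    proof (rule inj_if_trace_bounded_above [of _ "\<lambda>x. - J x"])
      have "- J x *v h = - (J x *v h)" for x h
        by (simp add: matrix_vector_mult_def vec_eq_iff sum_negf)
      then show "((\<lambda>x. - F x) has_derivative (\<lambda>h. - J x *v h)) (at x)" for x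
        using has_derivative_minus [OF der[of x]] by simp
      show "det (- J x) = 1" for x using det[of x] by (simp add: det_2)
      show "(- J x) $ 1 $ 1 + (- J x) $ 2 $ 2 < - c" for x using spec[OF t, of x] unfolding t_def by simp
    qed (intro continuous_intros cont)
    then show ?thesis by (simp add: inj_def)
  qed
qed

end
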